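(* Let $\mathbf{X}$ and $\mathbf{Y}$ be non-degenerate random vectors in $\mathbb{R}^d$ ($d\ge1$) with joint cumulative distribution functions $F(\mathbf{x})=\mathrm{P}(\mathbf{X}\le\mathbf{x})$ and $G(\mathbf{x})=\mathrm{P}(\mathbf{Y}\le\mathbf{x})$; assume $F\neq G$ and $F,G\in\mathcal{C}(\bar{\mathbb{R}}^d,d_e)$. Let $F_n$ be the empirical distribution function of a random sample of size $n$ from $\mathbf{X}$, and let $\mathbb{B}_F$ be an $F$-Brownian bridge. Then, as $n\to\infty$, with convergence in distribution: (i) $\displaystyle\sqrt{n}\,\big(\|F_n-G\|_\infty-\|F-G\|_\infty\big)\rightsquigarrow\sup_{M^+(|F-G|)}\big(\mathbb{B}_F\cdot\operatorname{sgn}(F-G)\big)$; (ii) $\displaystyle\sqrt{n}\,\big(\sup(F_n-G)-\sup(F-G)\big)\rightsquigarrow\sup_{M^+(F-G)}\mathbb{B}_F$; (iii) $\displaystyle\sqrt{n}\,\big(\operatorname{amp}(F_n-G)-\operatorname{amp}(F-G)\big)\rightsquigarrow\sup_{M^+(F-G)}\mathbb{B}_F-\inf_{M^-(F-G)}\mathbb{B}_F$.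
   Context: $\le$ is the coordinatewise order; $F_n(\mathbf{x})=\frac1n\sum_{i=1}^n1_{\{\mathbf{X}_i\le\mathbf{x}\}}$. Distribution functions are regarded as functions on $\bar{\mathbb{R}}^d$, $\bar{\mathbb{R}}=[-\infty,+\infty]$ (extended naturally). $d_e$ is the metric on $\bar{\mathbb{R}}^d$ transported from the Euclidean metric on $[0,1]^d$ by a fixed homeomorphism, and $\mathcal{C}(\bar{\mathbb{R}}^d,d_e)$ is the set of bounded continuous real functions on $\bar{\mathbb{R}}^d$. $\operatorname{amp}f=\sup f-\inf f$; $\operatorname{sgn}$ is the sign function. For a bounded function $h$ on $\bar{\mathbb{R}}^d$, $M^+(h)=\{\mathbf{x}\in\bar{\mathbb{R}}^d:h(\mathbf{x})=\sup h\}$, $M^-(h)=\{\mathbf{x}\in\bar{\mathbb{R}}^d:h(\mathbf{x})=\inf h\}$. The $F$-Brownian bridge $\mathbb{B}_F$ is the weak limit in $\ell^\infty(\bar{\mathbb{R}}^d)$ (bounded functions, supremum norm) of the empirical process $\sqrt{n}(F_n-F)$: a centered Gaussian process with covariance $\mathrm{E}(\mathbb{B}_F(\mathbf{x})\mathbb{B}_F(\mathbf{y}))=F(\mathbf{x}\wedge\mathbf{y})-F(\mathbf{x})F(\mathbf{y})$, $\wedge$ the coordinatewise minimum; when $F$ is continuous its paths are a.s. in $\mathcal{C}(\bar{\mathbb{R}}^d,d_e)$. *)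

theory Defs
  imports "HOL-Probability.Probability"
begin

definition ext_vec :: "real ^ 'd \<Rightarrow> ereal ^ 'd" where
  "ext_vec v = (\<chi> i. ereal (v $ i))"

text \<open>The order on \<^typ>\<open>ereal ^ 'd\<close> is the coordinatewise one, so this is
  $\mathrm{P}(X \le x)$ with \<open>x\<close> allowed to have infinite coordinates.\<close>

definition joint_cdf :: "'a measure \<Rightarrow> ('a \<Rightarrow> real ^ 'd) \<Rightarrow> ereal ^ 'd \<Rightarrow> real" where
  "joint_cdf M X x = measure M {\<omega> \<in> space M. ext_vec (X \<omega>) \<le> x}"

text \<open>The sample of size \<open>n\<close> is \<open>Xs 0, \<dots>, Xs (n - 1)\<close>.\<close>

definition emp_cdf :: "(nat \<Rightarrow> 'a \<Rightarrow> real ^ 'd) \<Rightarrow> nat \<Rightarrow> 'a \<Rightarrow> ereal ^ 'd \<Rightarrow> real" where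
  "emp_cdf Xs n \<omega> x = (1 / real n) * (\<Sum>i<n. if ext_vec (Xs i \<omega>) \<le> x then 1 else 0)"

definition nondegenerate :: "'a measure \<Rightarrow> ('a \<Rightarrow> real ^ 'd) \<Rightarrow> bool" where
  "nondegenerate M X \<longleftrightarrow> \<not> (\<exists>c. AE \<omega> in M. X \<omega> = c)"

definition iid_sample :: "'a measure \<Rightarrow> ('a \<Rightarrow> real ^ 'd) \<Rightarrow> (nat \<Rightarrow> 'a \<Rightarrow> real ^ 'd) \<Rightarrow> bool" where
  "iid_sample M X Xs \<longleftrightarrow>
     prob_space.indep_vars M (\<lambda>_. borel) Xs UNIV \<and>
     (\<forall>i. distr M borel (Xs i) = distr M borel X)"

text \<open>The metric $d_e$ transported from the unit cube by a homeomorphism \<open>\<phi>\<close>.\<close>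

definition de_metric :: "(ereal ^ 'd \<Rightarrow> real ^ 'd) \<Rightarrow> (ereal ^ 'd) metric" where
  "de_metric \<phi> = metric (UNIV, \<lambda>x y. dist (\<phi> x) (\<phi> y))"

definition C_de :: "(ereal ^ 'd \<Rightarrow> real ^ 'd) \<Rightarrow> (ereal ^ 'd \<Rightarrow> real) set" where
  "C_de \<phi> = mspace (cfunspace (mtopology_of (de_metric \<phi>)) euclidean_metric)"

definition sup_norm :: "('t \<Rightarrow> real) \<Rightarrow> real" where
  "sup_norm f = (SUP x. \<bar>f x\<bar>)"

definition amp :: "('t \<Rightarrow> real) \<Rightarrow> real" where
  "amp f = (SUP x. f x) - (INF x. f x)"

definition Mplus :: "('t \<Rightarrow> real) \<Rightarrow> 't set" where
  "Mplus h = {x. h x = (SUP y. h y)}"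

definition Mminus :: "('t \<Rightarrow> real) \<Rightarrow> 't set" where
  "Mminus h = {x. h x = (INF y. h y)}"

text \<open>\<^const>\<open>weak_conv_m\<close> only looks at distribution functions of the image measures, so
  measurability, without which \<^const>\<open>distr\<close> is junk, is required separately.\<close>

definition conv_in_distribution ::
    "'a measure \<Rightarrow> (nat \<Rightarrow> 'a \<Rightarrow> real) \<Rightarrow> 'b measure \<Rightarrow> ('b \<Rightarrow> real) \<Rightarrow> bool" where
  "conv_in_distribution M T N L \<longleftrightarrow>
     (\<forall>n. T n \<in> borel_measurable M) \<and> L \<in> borel_measurable N \<and>
     weak_conv_m (\<lambda>n. distr M borel (T n)) (distr N borel L)"

text \<open>The space $\ell^\infty$ of bounded functions with the supremum metric.\<close>

definition linf :: "('t \<Rightarrow> real) metric" where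
  "linf = funspace UNIV euclidean_metric"

definition borel_linf :: "('t \<Rightarrow> real) measure" where
  "borel_linf = sigma (mspace linf) {U. openin (mtopology_of linf) U}"

text \<open>Used for bounded \<open>f\<close> only, where it is the usual outer expectation.\<close>

definition outer_expectation :: "'a measure \<Rightarrow> ('a \<Rightarrow> real) \<Rightarrow> real" where
  "outer_expectation M f =
     Inf {(\<integral>\<omega>. U \<omega> \<partial>M) | U. integrable M U \<and> (\<forall>\<omega>\<in>space M. f \<omega> \<le> U \<omega>)}"

text \<open>Weak convergence in $\ell^\infty$ in the sense of Hoffmann-Jorgensen: the empirical process
  is not Borel measurable as a map into $\ell^\infty$, hence the outer expectation; the limit
  has to be Borel measurable.\<close>

definition weak_conv_linf ::
    "'a measure \<Rightarrow> (nat \<Rightarrow> 'a \<Rightarrow> 't \<Rightarrow> real) \<Rightarrow> 'b measure \<Rightarrow> ('b \<Rightarrow> 't \<Rightarrow> real) \<Rightarrow> bool" where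
  "weak_conv_linf M Z N B \<longleftrightarrow>
     (\<forall>n. \<forall>\<omega>\<in>space M. Z n \<omega> \<in> mspace linf) \<and>
     B \<in> measurable N borel_linf \<and>
     (\<forall>h. continuous_map (mtopology_of linf) euclideanreal h \<and> bounded (h ` mspace linf) \<longrightarrow>
        (\<lambda>n. outer_expectation M (\<lambda>\<omega>. h (Z n \<omega>))) \<longlonglongrightarrow> (\<integral>\<omega>. h (B \<omega>) \<partial>N))"

text \<open>Point masses count as (degenerate) Gaussian laws.\<close>

definition gaussian_rv :: "'b measure \<Rightarrow> ('b \<Rightarrow> real) \<Rightarrow> bool" where
  "gaussian_rv N Z \<longleftrightarrow> Z \<in> borel_measurable N \<and>
     ((\<exists>\<mu> \<sigma>. \<sigma> > 0 \<and> distributed N lborel Z (normal_density \<mu> \<sigma>)) \<or>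
      (\<exists>c. AE \<omega> in N. Z \<omega> = c))"

definition gaussian_process :: "'b measure \<Rightarrow> ('b \<Rightarrow> 't \<Rightarrow> real) \<Rightarrow> bool" where
  "gaussian_process N B \<longleftrightarrow>
     (\<forall>S a. finite S \<longrightarrow> gaussian_rv N (\<lambda>\<omega>. \<Sum>t\<in>S. a t * B \<omega> t))"

definition vec_min :: "ereal ^ 'd \<Rightarrow> ereal ^ 'd \<Rightarrow> ereal ^ 'd" where
  "vec_min x y = (\<chi> i. min (x $ i) (y $ i))"

text \<open>\<open>P\<close> is the law on $\mathbb{R}^d$ with distribution function \<open>F\<close>. The empirical process whose
  weak limit is taken is the canonical one, built from the coordinate projections on the
  infinite product of copies of \<open>P\<close>, so the notion depends on \<open>F\<close> only. No path continuity is
  required: for continuous \<open>F\<close> it is a consequence.\<close>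

definition F_brownian_bridge ::
    "(real ^ 'd) measure \<Rightarrow> 'b measure \<Rightarrow> ('b \<Rightarrow> ereal ^ 'd \<Rightarrow> real) \<Rightarrow> bool" where
  "F_brownian_bridge P N B \<longleftrightarrow>
     prob_space N \<and>
     (let F = joint_cdf P (\<lambda>v. v) in
        weak_conv_linf (\<Pi>\<^sub>M i\<in>(UNIV :: nat set). P)
          (\<lambda>n \<omega> x. sqrt (real n) * (emp_cdf (\<lambda>i \<omega>. \<omega> i) n \<omega> x - F x)) N B \<and>
        gaussian_process N B \<and>
        (\<forall>x. (\<integral>\<omega>. B \<omega> x \<partial>N) = 0) \<and>
        (\<forall>x y. (\<integral>\<omega>. B \<omega> x * B \<omega> y \<partial>N) = F (vec_min x y) - F x * F y))"

end

theory Submission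
  imports Defs
begin

text \<open>Write \<open>h = F - G\<close> and let \<open>Z n\<close> be the empirical process, so that \<open>F\<^sub>n - G = h + Z n / sqrt n\<close>.
  The difference quotient \<open>r (sup (h + z / r) - sup h)\<close> is at least the supremum of \<open>z\<close> over the maximisers
  of \<open>h\<close> and, once \<open>r\<close> is large compared with \<open>z\<close>, at most its supremum over the \<open>\<epsilon>\<close>-maximisers. Both
  bounds are continuous in \<open>z\<close> for the supremum norm, and by compactness they merge as \<open>\<epsilon> \<rightarrow> 0\<close> when \<open>z\<close>
  is continuous. The weak convergence of \<open>Z n\<close> to the bridge \<open>B\<close> therefore passes to the difference
  quotients provided that \<open>B\<close> has continuous paths. This holds because the sample has almost surely no
  ties in any coordinate: the local oscillation of \<open>Z n\<close> is then \<open>O(1 / sqrt n)\<close>, and the local oscillation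
  is a continuous functional on \<open>\<ell>\<^sup>\<infinity>\<close>, hence vanishes at \<open>B\<close>.\<close>

section \<open>Bounded functions with the supremum metric\<close>

lemma mspace_linf: "z \<in> mspace linf \<longleftrightarrow> (\<exists>K. \<forall>x. \<bar>z x\<bar> \<le> K)"
proof -
  have "z \<in> mspace linf \<longleftrightarrow> bounded (range z)"
    by (simp add: linf_def Met_TC.fspace_def)
  then show ?thesis
    by (auto simp: bounded_real)
qed

lemma linf_boundE:
  assumes "z \<in> mspace linf" obtains K where "0 \<le> K" "\<And>x. \<bar>z x\<bar> \<le> K"
  using assms mspace_linf[of z] by (meson abs_ge_zero order_trans)

lemma abs_diff_le_mdist_linf:
  assumes "z \<in> mspace linf" "w \<in> mspace linf"
  shows "\<bar>z x - w x\<bar> \<le> mdist linf z w"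
  using Metric_space.funspace_mdist_le[OF Metric_space_mspace_mdist, of z euclidean_metric UNIV w "mdist linf z w"] assms
  by (simp add: linf_def dist_real_def)

text \<open>The hypothesis is symmetric in \<open>z\<close> and \<open>w\<close>, so a one-sided
  inequality suffices; taking \<open>K\<close> to be the distance, in both orders, gives the
  Lipschitz bound.\<close>

lemma linf_lipschitzI:
  fixes \<Phi> :: "('t \<Rightarrow> real) \<Rightarrow> real"
  assumes "\<And>z w K. \<lbrakk>z \<in> mspace linf; w \<in> mspace linf; \<And>x. \<bar>z x - w x\<bar> \<le> K\<rbrakk> \<Longrightarrow> \<Phi> z \<le> \<Phi> w + L * K"
  shows "continuous_map (mtopology_of linf) euclideanreal \<Phi>"
proof -
  have "\<bar>\<Phi> z - \<Phi> w\<bar> \<le> L * mdist linf z w" if "z \<in> mspace linf" "w \<in> mspace linf" for z w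
    using assms[of z w "mdist linf z w"] assms[of w z "mdist linf z w"] abs_diff_le_mdist_linf[of z w] that
    by (fastforce simp: abs_le_iff abs_minus_commute)
  then have "Lipschitz_continuous_map linf euclidean_metric \<Phi>"
    by (auto simp: Lipschitz_continuous_map_def dist_real_def)
  then show ?thesis
    using Lipschitz_continuous_imp_continuous_map by fastforce
qed

text \<open>The weights \<open>c\<close> and the map \<open>g\<close> let one statement cover
  suprema of \<open>z\<close>, of \<open>- z\<close> and of \<open>z\<close> with a sign attached to
  each point. Weights of modulus at most 1 keep the Lipschitz constant 1.\<close>

lemma continuous_map_SUP_linf:
  fixes c :: "'p \<Rightarrow> real" and g :: "'p \<Rightarrow> 't"
  assumes "A \<noteq> {}" "\<And>p. p \<in> A \<Longrightarrow> \<bar>c p\<bar> \<le> 1"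
  shows "continuous_map (mtopology_of linf) euclideanreal (\<lambda>z. SUP p\<in>A. c p * z (g p))"
proof (rule linf_lipschitzI[where L = 1])
  fix z w :: "'t \<Rightarrow> real" and K
  assume zw: "z \<in> mspace linf" "w \<in> mspace linf" and K: "\<And>x. \<bar>z x - w x\<bar> \<le> K"
  obtain C where C: "\<And>x. \<bar>w x\<bar> \<le> C" "0 \<le> C" using linf_boundE[OF zw(2)] by blast
  have cb: "\<bar>c p * a\<bar> \<le> b" if "p \<in> A" "\<bar>a\<bar> \<le> b" for p a b
    using assms(2)[OF that(1)] that(2) mult_mono[of "\<bar>c p\<bar>" 1 "\<bar>a\<bar>" b] by (simp add: abs_mult)
  have bdd: "bdd_above ((\<lambda>p. c p * w (g p)) ` A)"
    using cb[OF _ C(1)] by (intro bdd_aboveI2[of _ _ C]) (auto simp: abs_le_iff)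
  show "(SUP p\<in>A. c p * z (g p)) \<le> (SUP p\<in>A. c p * w (g p)) + 1 * K"
  proof (rule cSUP_least[OF assms(1)])
    fix p assume p: "p \<in> A"
    have "c p * z (g p) \<le> c p * w (g p) + K"
      using cb[OF p K[of "g p"]] by (simp add: algebra_simps abs_le_iff)
    also have "c p * w (g p) \<le> (SUP p\<in>A. c p * w (g p))"
      by (rule cSUP_upper[OF p bdd])
    finally show "c p * z (g p) \<le> (SUP p\<in>A. c p * w (g p)) + 1 * K" by simp
  qed
qed

lemma continuous_map_sup_norm_linf:
  "continuous_map (mtopology_of linf) euclideanreal (sup_norm :: ('t \<Rightarrow> real) \<Rightarrow> real)"
proof (rule linf_lipschitzI[where L = 1])
  fix z w :: "'t \<Rightarrow> real" and K
  assume zw: "z \<in> mspace linf" "w \<in> mspace linf" and K: "\<And>x. \<bar>z x - w x\<bar> \<le> K"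
  obtain C where C: "\<And>x. \<bar>w x\<bar> \<le> C" using linf_boundE[OF zw(2)] by blast
  have "\<bar>z x\<bar> \<le> sup_norm w + 1 * K" for x
    using K[of x] cSUP_upper[of x UNIV "\<lambda>x. \<bar>w x\<bar>"] C unfolding sup_norm_def
    by (smt (verit) UNIV_I bdd_aboveI2)
  then show "sup_norm z \<le> sup_norm w + 1 * K"
    unfolding sup_norm_def by (intro cSUP_least) auto
qed

lemma borel_measurable_linf:
  fixes \<Phi> :: "('t \<Rightarrow> real) \<Rightarrow> real"
  assumes "continuous_map (mtopology_of linf) euclideanreal \<Phi>"
  shows "\<Phi> \<in> borel_measurable borel_linf"
proof (rule borel_measurableI)
  fix S :: "real set" assume "open S"
  have sub: "{U :: ('t \<Rightarrow> real) set. openin (mtopology_of linf) U} \<subseteq> Pow (mspace linf)"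
    using openin_subset by fastforce
  have "openin (mtopology_of linf) {x \<in> mspace linf. \<Phi> x \<in> S}"
    using openin_continuous_map_preimage[OF assms, of S] \<open>open S\<close> by simp
  then show "\<Phi> -` S \<inter> space borel_linf \<in> sets borel_linf"
    unfolding borel_linf_def space_measure_of[OF sub] sets_measure_of[OF sub]
    by (intro sigma_sets.Basic) (simp add: vimage_def Int_def conj_commute)
qed

lemma space_borel_linf: "space borel_linf = mspace linf"
  unfolding borel_linf_def by (rule space_measure_of) (use openin_subset in fastforce)

lemma continuous_map_compose_linf:
  fixes f :: "real \<Rightarrow> real"
  assumes "continuous_map (mtopology_of linf) euclideanreal \<Phi>" "continuous_on UNIV f"
  shows "continuous_map (mtopology_of linf) euclideanreal (\<lambda>z. f (\<Phi> z))"
  using continuous_map_compose[OF assms(1), of euclideanreal f] assms(2) by (simp add: comp_def)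

section \<open>Bounds for outer expectations\<close>

text \<open>Every integrable majorant of \<open>g\<close> also majorises \<open>f\<close>. The
  constant \<open>K\<close> is such a majorant, so the infimum is over a nonempty set.\<close>

lemma integral_le_outer_expectation:
  assumes "prob_space M" "integrable M f" "\<And>\<omega>. \<omega> \<in> space M \<Longrightarrow> f \<omega> \<le> g \<omega>" "\<And>\<omega>. \<omega> \<in> space M \<Longrightarrow> g \<omega> \<le> K"
  shows "(\<integral>\<omega>. f \<omega> \<partial>M) \<le> outer_expectation M g"
  unfolding outer_expectation_def
proof (rule cInf_greatest)
  interpret prob_space M by fact
  have "integrable M (\<lambda>_. K)" by simp
  then show "{(\<integral>\<omega>. U \<omega> \<partial>M) | U. integrable M U \<and> (\<forall>\<omega>\<in>space M. g \<omega> \<le> U \<omega>)} \<noteq> {}"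
    using assms(4) by blast
qed (use assms(2,3) in \<open>auto intro!: integral_mono intro: order_trans\<close>)

text \<open>\<open>U\<close> is one of the competitors in the infimum; the lower bound
  \<open>K\<close> keeps the set of their integrals bounded below.\<close>

lemma outer_expectation_le_integral:
  assumes "prob_space M" "integrable M U" "\<And>\<omega>. \<omega> \<in> space M \<Longrightarrow> g \<omega> \<le> U \<omega>" "\<And>\<omega>. \<omega> \<in> space M \<Longrightarrow> K \<le> g \<omega>"
  shows "outer_expectation M g \<le> (\<integral>\<omega>. U \<omega> \<partial>M)"
  unfolding outer_expectation_def
proof (rule cInf_lower)
  interpret prob_space M by fact
  have "K \<le> (\<integral>\<omega>. V \<omega> \<partial>M)" if "integrable M V" "\<forall>\<omega>\<in>space M. g \<omega> \<le> V \<omega>" for V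
    using integral_mono[of M "\<lambda>_. K" V] that assms(4) by (force simp: prob_space)
  then show "bdd_below {(\<integral>\<omega>. U \<omega> \<partial>M) | U. integrable M U \<and> (\<forall>\<omega>\<in>space M. g \<omega> \<le> U \<omega>)}"
    by (intro bdd_belowI[of _ K]) auto
qed (use assms in blast)

section \<open>Perturbed suprema\<close>

text \<open>Relative to a set \<open>S\<close> because the absolute value is later treated as a
  supremum over points paired with signs, which form a proper subset of their type.\<close>

definition near_max :: "'a set \<Rightarrow> ('a \<Rightarrow> real) \<Rightarrow> real \<Rightarrow> 'a set" where
  "near_max S h \<epsilon> = {x \<in> S. (SUP y\<in>S. h y) - \<epsilon> \<le> h x}"

lemma near_max_nonempty:
  fixes h :: "'a::topological_space \<Rightarrow> real"
  assumes "compact S" "S \<noteq> {}" "continuous_on S h" "0 \<le> \<epsilon>"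
  shows "near_max S h \<epsilon> \<noteq> {}"
proof -
  obtain x where x: "x \<in> S" "\<forall>y\<in>S. h y \<le> h x"
    using continuous_attains_sup[OF assms(1-3)] by blast
  have "(SUP y\<in>S. h y) \<le> h x"
    using x assms(2) by (intro cSUP_least) auto
  then show ?thesis using x assms(4) by (auto simp: near_max_def)
qed

lemma near_max_0:
  assumes "bdd_above (h ` S)"
  shows "near_max S h 0 = {x \<in> S. h x = (SUP y\<in>S. h y)}"
  using cSUP_upper[OF _ assms] by (force simp: near_max_def)

text \<open>At a maximiser \<open>x\<close> of \<open>h\<close> the perturbed function takes the
  value \<open>sup h + z x / r\<close>.\<close>

lemma sup_excess_ge:
  fixes h z :: "'a \<Rightarrow> real"
  assumes "near_max S h 0 \<noteq> {}" "bdd_above (h ` S)" "\<And>x. x \<in> S \<Longrightarrow> z x \<le> K" "0 < r"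
  shows "(SUP x\<in>near_max S h 0. z x) \<le> r * ((SUP x\<in>S. h x + z x / r) - (SUP x\<in>S. h x))"
proof (rule cSUP_least[OF assms(1)])
  fix x assume x: "x \<in> near_max S h 0"
  obtain H where H: "\<And>y. y \<in> S \<Longrightarrow> h y \<le> H"
    using assms(2) by (auto simp: bdd_above_def)
  have "bdd_above ((\<lambda>x. h x + z x / r) ` S)"
    using H assms(3,4) by (intro bdd_aboveI2[of _ _ "H + K / r"] add_mono divide_right_mono) auto
  then have "h x + z x / r \<le> (SUP x\<in>S. h x + z x / r)"
    using x by (intro cSUP_upper) (auto simp: near_max_def)
  then have "z x / r \<le> (SUP x\<in>S. h x + z x / r) - (SUP x\<in>S. h x)"
    using x by (auto simp: near_max_def)
  then show "z x \<le> r * ((SUP x\<in>S. h x + z x / r) - (SUP x\<in>S. h x))"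
    using \<open>0 < r\<close> by (simp add: field_simps)
qed

text \<open>Off \<^term>\<open>near_max S h \<epsilon>\<close> the perturbation \<open>z / r\<close> is too small to reach the supremum.\<close>

lemma sup_excess_le:
  fixes h z :: "'a \<Rightarrow> real"
  assumes "near_max S h 0 \<noteq> {}" "bdd_above (h ` S)" "\<And>x. x \<in> S \<Longrightarrow> \<bar>z x\<bar> \<le> K" "0 < r" "2 * K \<le> \<epsilon> * r"
  shows "r * ((SUP x\<in>S. h x + z x / r) - (SUP x\<in>S. h x)) \<le> (SUP x\<in>near_max S h \<epsilon>. z x)"
proof -
  let ?s = "SUP x\<in>S. h x" and ?u = "SUP x\<in>near_max S h \<epsilon>. z x"
  have bdd: "bdd_above (z ` near_max S h \<epsilon>)"
    using assms(3) by (intro bdd_aboveI2[of _ _ K]) (auto simp: near_max_def abs_le_iff)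
  obtain x0 where x0: "x0 \<in> near_max S h 0" using assms(1) by blast
  have K: "0 \<le> K" using assms(3)[of x0] x0 by (auto simp: near_max_def)
  then have "0 \<le> \<epsilon>" using assms(4,5) by (smt (verit) mult_neg_pos)
  then have "x0 \<in> near_max S h \<epsilon>" using x0 by (auto simp: near_max_def)
  then have "z x0 \<le> ?u" by (intro cSUP_upper bdd)
  then have u: "- K \<le> ?u" using assms(3)[of x0] x0 by (auto simp: near_max_def)
  have "(SUP x\<in>S. h x + z x / r) \<le> ?s + ?u / r"
  proof (rule cSUP_least)
    show "S \<noteq> {}" using x0 by (auto simp: near_max_def)
    fix x assume x: "x \<in> S"
    show "h x + z x / r \<le> ?s + ?u / r"
    proof (cases "x \<in> near_max S h \<epsilon>")
      case True
      then show ?thesis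
        using cSUP_upper[OF True bdd] cSUP_upper[OF x assms(2)] \<open>0 < r\<close>
        by (intro add_mono divide_right_mono) auto
    next
      case False
      \<comment> \<open>Here \<open>h\<close> loses \<open>\<epsilon>\<close>, \<open>z / r\<close>
        gains at most \<open>K / r\<close>, and the target \<open>?u / r\<close> may be as low as
        \<open>- K / r\<close>: hence the factor 2 in
        \<open>2 * K \<le> \<epsilon> * r\<close>.\<close>
      then have "h x \<le> ?s - \<epsilon>" using x by (auto simp: near_max_def)
      moreover have "z x / r \<le> K / r" "- K / r \<le> ?u / r"
        using assms(3)[OF x] u \<open>0 < r\<close> by (auto intro!: divide_right_mono simp: abs_le_iff simp del: divide_minus_left minus_divide_left)
      moreover have "2 * K / r \<le> \<epsilon>" using assms(4,5) by (simp add: field_simps)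
      ultimately show ?thesis by simp
    qed
  qed
  then show ?thesis using \<open>0 < r\<close> by (simp add: field_simps)
qed

text \<open>The points where \<open>z\<close> exceeds the limit by \<open>\<delta> / 2\<close> form
  a compact set without maximisers of \<open>h\<close>, so \<open>h\<close> stays some
  \<open>e > 0\<close> below its supremum there. Once \<open>\<epsilon> m < e\<close>, the
  near-maximisers avoid this set.\<close>

lemma tendsto_SUP_near_max:
  fixes h z :: "'a::topological_space \<Rightarrow> real"
  assumes S: "compact S" "S \<noteq> {}" and h: "continuous_on S h" and z: "continuous_on S z"
    and \<epsilon>: "\<epsilon> \<longlonglongrightarrow> 0" "\<And>m. 0 \<le> \<epsilon> m"
  shows "(\<lambda>m. SUP x\<in>near_max S h (\<epsilon> m). z x) \<longlonglongrightarrow> (SUP x\<in>near_max S h 0. z x)"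
proof (rule LIMSEQ_I)
  fix \<delta> :: real assume "0 < \<delta>"
  let ?s = "SUP x\<in>S. h x" and ?u = "SUP x\<in>near_max S h 0. z x"
  let ?A = "{x \<in> S. ?u + \<delta> / 2 \<le> z x}"
  have bz: "bdd_above (z ` near_max S h e)" for e
    using bounded_imp_bdd_above[OF compact_imp_bounded[OF compact_continuous_image[OF z S(1)]]]
    by (rule bdd_above_mono) (auto simp: near_max_def)
  have bh: "bdd_above (h ` S)"
    using bounded_imp_bdd_above[OF compact_imp_bounded[OF compact_continuous_image[OF h S(1)]]] .
  have "\<exists>e>0. \<forall>x\<in>?A. h x < ?s - e"
  proof (cases "?A = {}")
    case True then show ?thesis by (intro exI[of _ 1]) auto
  next
    case False
    have "compact ?A"
      using continuous_closedin_preimage[OF z, of "{?u + \<delta> / 2..}"] S(1)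
      by (auto simp: vimage_def Int_def intro: closedin_compact)
    then obtain a where a: "a \<in> ?A" "\<forall>x\<in>?A. h x \<le> h a"
      using continuous_attains_sup[OF _ False continuous_on_subset[OF h]] by auto
    have "a \<notin> near_max S h 0"
      using cSUP_upper[OF _ bz, of a 0] a \<open>0 < \<delta>\<close> by auto
    then have "h a < ?s" using a by (auto simp: near_max_def)
    then show ?thesis using a by (intro exI[of _ "(?s - h a) / 2"]) (auto simp: field_simps)
  qed
  then obtain e where e: "0 < e" "\<And>x. x \<in> ?A \<Longrightarrow> h x < ?s - e" by blast
  obtain m0 where m0: "\<And>m. m \<ge> m0 \<Longrightarrow> \<epsilon> m < e"
    using order_tendstoD(2)[OF \<epsilon>(1) e(1)] by (auto simp: eventually_sequentially)
  have "\<bar>(SUP x\<in>near_max S h (\<epsilon> m). z x) - ?u\<bar> < \<delta>" if "m \<ge> m0" for m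
  proof -
    have ne: "near_max S h (\<epsilon> m) \<noteq> {}" "near_max S h 0 \<noteq> {}"
      using near_max_nonempty[OF S h] \<epsilon>(2) by auto
    have "(SUP x\<in>near_max S h (\<epsilon> m). z x) \<le> ?u + \<delta> / 2"
      using e(2) m0[OF that] by (intro cSUP_least ne) (force simp: near_max_def)
    moreover have "?u \<le> (SUP x\<in>near_max S h (\<epsilon> m). z x)"
      using \<epsilon>(2)[of m] by (intro cSUP_subset_mono ne bz) (auto simp: near_max_def)
    ultimately show ?thesis using \<open>0 < \<delta>\<close> by (simp add: abs_if)
  qed
  then show "\<exists>n0. \<forall>n\<ge>n0. norm ((SUP x\<in>near_max S h (\<epsilon> n). z x) - ?u) < \<delta>" by auto
qed

section \<open>Weak convergence of squeezed functionals\<close>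

text \<open>An outer expectation bounds the integrals of measurable minorants from above, so the
  estimate is one-sided. Used for a test function and for one minus a test function, it yields both
  halves of a limit.\<close>

lemma weak_conv_linf_integral_bound:
  assumes wc: "weak_conv_linf M Z N B" and M: "prob_space M"
    and h: "continuous_map (mtopology_of linf) euclideanreal h" "\<And>z. \<bar>h z\<bar> \<le> 1"
    and T: "\<And>n. integrable M (T n)" "\<forall>\<^sub>F n in sequentially. \<forall>\<omega>\<in>space M. T n \<omega> \<le> h (Z n \<omega>)"
    and e: "0 < e"
  shows "\<forall>\<^sub>F n in sequentially. (\<integral>\<omega>. T n \<omega> \<partial>M) < (\<integral>\<omega>. h (B \<omega>) \<partial>N) + e"
proof -
  have "bounded (h ` mspace linf)"
    using h(2) by (auto simp: bounded_real)
  then have "(\<lambda>n. outer_expectation M (\<lambda>\<omega>. h (Z n \<omega>))) \<longlonglongrightarrow> (\<integral>\<omega>. h (B \<omega>) \<partial>N)"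
    using wc h(1) by (auto simp: weak_conv_linf_def)
  then have "\<forall>\<^sub>F n in sequentially. outer_expectation M (\<lambda>\<omega>. h (Z n \<omega>)) < (\<integral>\<omega>. h (B \<omega>) \<partial>N) + e"
    using e by (intro order_tendstoD(2)) auto
  with T(2) show ?thesis
  proof eventually_elim
    case (elim n)
    have "(\<integral>\<omega>. T n \<omega> \<partial>M) \<le> outer_expectation M (\<lambda>\<omega>. h (Z n \<omega>))"
      using elim h(2) by (intro integral_le_outer_expectation[OF M T(1), of _ _ 1]) (auto simp: abs_le_iff)
    then show ?case using elim by simp
  qed
qed

text \<open>An extended continuous mapping theorem. The functionals producing \<open>T n\<close> converge only along
  continuous functions, so they are squeezed between fixed continuous functionals, which is enough
  because the law of \<open>T n\<close> is tested against the decreasing functions \<^const>\<open>cts_step\<close> alone.\<close>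

lemma conv_in_distribution_squeeze:
  fixes \<Phi> :: "('t \<Rightarrow> real) \<Rightarrow> real" and \<Psi> :: "nat \<Rightarrow> ('t \<Rightarrow> real) \<Rightarrow> real"
  assumes wc: "weak_conv_linf M Z N B" and M: "prob_space M" and N: "prob_space N"
    and T[measurable]: "\<And>n. T n \<in> borel_measurable M"
    and \<Phi>: "continuous_map (mtopology_of linf) euclideanreal \<Phi>"
    and \<Psi>: "\<And>m. continuous_map (mtopology_of linf) euclideanreal (\<Psi> m)"
    and lower: "\<forall>\<^sub>F n in sequentially. \<forall>\<omega>\<in>space M. \<Phi> (Z n \<omega>) \<le> T n \<omega>"
    and upper: "\<And>m. \<forall>\<^sub>F n in sequentially. \<forall>\<omega>\<in>space M. (\<forall>x. \<bar>Z n \<omega> x\<bar> \<le> real m) \<longrightarrow> T n \<omega> \<le> \<Psi> m (Z n \<omega>)"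
    and lim: "AE \<omega> in N. (\<lambda>m. \<Psi> m (B \<omega>)) \<longlonglongrightarrow> \<Phi> (B \<omega>)"
  shows "conv_in_distribution M T N (\<lambda>\<omega>. \<Phi> (B \<omega>))"
proof -
  interpret M: prob_space M by fact
  interpret N: prob_space N by fact
  have Z: "Z n \<omega> \<in> mspace linf" if "\<omega> \<in> space M" for n \<omega>
    using wc that by (auto simp: weak_conv_linf_def)
  have B: "B \<in> measurable N borel_linf"
    using wc by (auto simp: weak_conv_linf_def)
  have Bsp: "B \<omega> \<in> mspace linf" if "\<omega> \<in> space N" for \<omega>
    using measurable_space[OF B that] by (simp add: space_borel_linf)
  have meas: "(\<lambda>\<omega>. \<Theta> (B \<omega>)) \<in> borel_measurable N"
    if "continuous_map (mtopology_of linf) euclideanreal \<Theta>" for \<Theta>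
    using measurable_compose[OF B borel_measurable_linf[OF that]] .
  note [measurable] = meas[OF \<Phi>] meas[OF \<Psi>] meas[OF continuous_map_sup_norm_linf]
  have "weak_conv_m (\<lambda>n. distr M borel (T n)) (distr N borel (\<lambda>\<omega>. \<Phi> (B \<omega>)))"
  proof (rule integral_cts_step_conv_imp_weak_conv)
    show "real_distribution (distr M borel (T n))" for n
      by (rule M.real_distribution_distr) simp
    show "real_distribution (distr N borel (\<lambda>\<omega>. \<Phi> (B \<omega>)))"
      by (rule N.real_distribution_distr) simp
    fix a b :: real assume "a < b"
    define f where "f = cts_step a b"
    have f_cont: "continuous_on UNIV f"
      unfolding f_def by (rule uniformly_continuous_imp_continuous[OF cts_step_uniformly_continuous[OF \<open>a < b\<close>]])
    have [measurable]: "f \<in> borel_measurable borel"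
      using f_cont by (rule borel_measurable_continuous_onI)
    have f01: "0 \<le> f x" "f x \<le> 1" for x
      using \<open>a < b\<close> by (auto simp: f_def cts_step_def)
    have f_anti: "f y \<le> f x" if "x \<le> y" for x y
      using \<open>a < b\<close> that by (auto simp: f_def cts_step_def divide_right_mono)
    have intT: "integrable M (\<lambda>\<omega>. f (T n \<omega>))" for n
      using f01 by (intro M.integrable_const_bound[of _ 1]) auto
    have intB: "integrable N (\<lambda>\<omega>. f (\<Phi> (B \<omega>)))"
      using f01 by (intro N.integrable_const_bound[of _ 1]) auto
    \<comment> \<open>A continuous majorant of \<open>1 - f (T n)\<close>: if
      \<open>\<bar>Z n\<bar> \<le> m\<close> the bound by \<open>\<Psi> m\<close> applies, otherwise
      the second summand is at least 1 and the cap is reached. For a fixed path the second summand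
      vanishes once \<open>m\<close> is at least \<open>sup_norm z + 1\<close>.\<close>
    define k where "k m z = min 1 (1 - f (\<Psi> m z) + max 0 (sup_norm z - real m + 1))" for m and z :: "'t \<Rightarrow> real"
    have k_cont: "continuous_map (mtopology_of linf) euclideanreal (k m)" for m
      unfolding k_def
      by (intro continuous_map_real_min continuous_map_real_max continuous_map_add continuous_map_diff
          continuous_map_sup_norm_linf continuous_map_compose_linf[OF \<Psi>] f_cont) auto
    have k01: "0 \<le> k m z" "k m z \<le> 1" for m z
      using f01[of "\<Psi> m z"] by (auto simp: k_def)
    note [measurable] = meas[OF k_cont]
    have k_lim: "(\<lambda>m. \<integral>\<omega>. k m (B \<omega>) \<partial>N) \<longlonglongrightarrow> (\<integral>\<omega>. 1 - f (\<Phi> (B \<omega>)) \<partial>N)"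
    proof (rule integral_dominated_convergence[where w = "\<lambda>_. 1"])
      show "AE \<omega> in N. (\<lambda>m. k m (B \<omega>)) \<longlonglongrightarrow> 1 - f (\<Phi> (B \<omega>))"
        using lim
      proof (rule AE_mp, intro AE_I2 impI)
        fix \<omega> assume \<omega>: "\<omega> \<in> space N" and l: "(\<lambda>m. \<Psi> m (B \<omega>)) \<longlonglongrightarrow> \<Phi> (B \<omega>)"
        have "(\<lambda>m. f (\<Psi> m (B \<omega>))) \<longlonglongrightarrow> f (\<Phi> (B \<omega>))"
          using continuous_on_tendsto_compose[OF f_cont l] by simp
        then have "(\<lambda>m. 1 - f (\<Psi> m (B \<omega>))) \<longlonglongrightarrow> 1 - f (\<Phi> (B \<omega>))"
          by (intro tendsto_intros)
        moreover have "\<forall>\<^sub>F m in sequentially. 1 - f (\<Psi> m (B \<omega>)) = k m (B \<omega>)"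
          using eventually_ge_at_top[of "nat \<lceil>sup_norm (B \<omega>) + 1\<rceil>"]
        proof eventually_elim
          case (elim m)
          then have "max 0 (sup_norm (B \<omega>) - real m + 1) = 0" by linarith
          then show ?case using f01[of "\<Psi> m (B \<omega>)"] unfolding k_def by simp
        qed
        ultimately show "(\<lambda>m. k m (B \<omega>)) \<longlonglongrightarrow> 1 - f (\<Phi> (B \<omega>))"
          by (rule Lim_transform_eventually)
      qed
    qed (use k01 in \<open>auto simp: abs_le_iff intro: order_trans[of _ 0]\<close>)
    have "(\<lambda>n. \<integral>\<omega>. f (T n \<omega>) \<partial>M) \<longlonglongrightarrow> (\<integral>\<omega>. f (\<Phi> (B \<omega>)) \<partial>N)"
    proof (rule order_tendstoI)
      fix c assume "(\<integral>\<omega>. f (\<Phi> (B \<omega>)) \<partial>N) < c"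
      moreover have "\<forall>\<^sub>F n in sequentially. \<forall>\<omega>\<in>space M. f (T n \<omega>) \<le> f (\<Phi> (Z n \<omega>))"
        using lower by eventually_elim (auto intro: f_anti)
      ultimately show "\<forall>\<^sub>F n in sequentially. (\<integral>\<omega>. f (T n \<omega>) \<partial>M) < c"
        using weak_conv_linf_integral_bound[OF wc M continuous_map_compose_linf[OF \<Phi> f_cont] _ intT,
            where e = "c - (\<integral>\<omega>. f (\<Phi> (B \<omega>)) \<partial>N)"] f01
        by simp
    next
      fix c assume c: "c < (\<integral>\<omega>. f (\<Phi> (B \<omega>)) \<partial>N)"
      \<comment> \<open>The lower half of the limit is the upper half for \<open>1 - f\<close>.
        First \<open>m\<close> is fixed so that \<open>k m\<close> is nearly optimal at
        \<open>B\<close>, and only then does \<open>n\<close> grow.\<close>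
      have "(\<integral>\<omega>. 1 - f (\<Phi> (B \<omega>)) \<partial>N) < 1 - c"
        using c intB by (simp add: N.prob_space)
      then obtain m where m: "(\<integral>\<omega>. k m (B \<omega>) \<partial>N) < 1 - c"
        using order_tendstoD(2)[OF k_lim] by (auto simp: eventually_sequentially)
      have "\<forall>\<^sub>F n in sequentially. \<forall>\<omega>\<in>space M. 1 - f (T n \<omega>) \<le> k m (Z n \<omega>)"
        using upper[of m]
      proof eventually_elim
        case (elim n)
        show ?case
        proof
          fix \<omega> assume \<omega>: "\<omega> \<in> space M"
          show "1 - f (T n \<omega>) \<le> k m (Z n \<omega>)"
          proof (cases "\<forall>x. \<bar>Z n \<omega> x\<bar> \<le> real m")
            case True
            then have "f (\<Psi> m (Z n \<omega>)) \<le> f (T n \<omega>)" using elim \<omega> by (intro f_anti) auto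
            then show ?thesis using f01[of "T n \<omega>"] by (auto simp: k_def)
          next
            case False
            then obtain x where x: "real m < \<bar>Z n \<omega> x\<bar>" by (auto simp: not_le)
            obtain K where "\<And>x. \<bar>Z n \<omega> x\<bar> \<le> K" using linf_boundE[OF Z[OF \<omega>]] by metis
            then have "\<bar>Z n \<omega> x\<bar> \<le> sup_norm (Z n \<omega>)"
              unfolding sup_norm_def by (intro cSUP_upper bdd_aboveI2) auto
            then have "k m (Z n \<omega>) = 1"
              using x f01[of "\<Psi> m (Z n \<omega>)"] by (auto simp: k_def)
            then show ?thesis using f01[of "T n \<omega>"] by simp
          qed
        qed
      qed
      then have "\<forall>\<^sub>F n in sequentially. (\<integral>\<omega>. 1 - f (T n \<omega>) \<partial>M) < 1 - c"
        using weak_conv_linf_integral_bound[OF wc M k_cont, of m "\<lambda>n \<omega>. 1 - f (T n \<omega>)"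
            "(1 - c) - (\<integral>\<omega>. k m (B \<omega>) \<partial>N)"] m k01 intT
        by (simp add: abs_le_iff order_trans[of _ 0])
      then show "\<forall>\<^sub>F n in sequentially. c < (\<integral>\<omega>. f (T n \<omega>) \<partial>M)"
        using intT by (simp add: M.prob_space)
    qed
    then show "(\<lambda>n. integral\<^sup>L (distr M borel (T n)) (cts_step a b)) \<longlonglongrightarrow>
        integral\<^sup>L (distr N borel (\<lambda>\<omega>. \<Phi> (B \<omega>))) (cts_step a b)"
      by (simp add: integral_distr f_def[symmetric])
  qed
  then show ?thesis
    by (auto simp: conv_in_distribution_def)
qed

text \<open>Convergence in distribution depends on the laws of the \<open>T n\<close> only, and
  \<open>g\<close> carries \<open>M\<close> to \<open>Q\<close>. This moves limits from the
  canonical product space to the space of the given sample.\<close>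

lemma conv_in_distribution_transfer:
  assumes "conv_in_distribution Q T N L" and g: "g \<in> measurable M Q" and "distr M Q g = Q"
  shows "conv_in_distribution M (\<lambda>n \<omega>. T n (g \<omega>)) N L"
proof -
  have T: "T n \<in> borel_measurable Q" for n
    using assms(1) by (auto simp: conv_in_distribution_def)
  have "distr M borel (\<lambda>\<omega>. T n (g \<omega>)) = distr Q borel (T n)" for n
    using distr_distr[OF T g, of n] assms(3) by (simp add: comp_def)
  then show ?thesis
    using assms(1) measurable_compose[OF g T] by (auto simp: conv_in_distribution_def)
qed

section \<open>Path continuity of weak limits\<close>

text \<open>The greatest local oscillation of \<open>z\<close>. It vanishes exactly at the continuous functions and,
  unlike a modulus of continuity, it is defined through the topology alone.\<close>

definition osc_bounds :: "('t::topological_space \<Rightarrow> real) \<Rightarrow> real set" where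
  "osc_bounds z = {c. 0 \<le> c \<and> (\<forall>p. \<exists>U. open U \<and> p \<in> U \<and> (\<forall>x\<in>U. \<forall>y\<in>U. \<bar>z x - z y\<bar> \<le> c))}"

definition osc :: "('t::topological_space \<Rightarrow> real) \<Rightarrow> real" where
  "osc z = Inf (osc_bounds z)"

lemma osc_boundsD:
  "c \<in> osc_bounds z \<Longrightarrow> \<exists>U. open U \<and> p \<in> U \<and> (\<forall>x\<in>U. \<forall>y\<in>U. \<bar>z x - z y\<bar> \<le> c)"
  by (auto simp: osc_bounds_def)

lemma bdd_below_osc_bounds: "bdd_below (osc_bounds z)"
  by (rule bdd_belowI[of _ 0]) (auto simp: osc_bounds_def)

lemma osc_bounds_nonempty: "z \<in> mspace linf \<Longrightarrow> osc_bounds z \<noteq> {}"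
proof -
  assume "z \<in> mspace linf"
  then obtain K where K: "0 \<le> K" "\<And>x. \<bar>z x\<bar> \<le> K" using linf_boundE by blast
  have "\<bar>z x - z y\<bar> \<le> 2 * K" for x y using K(2)[of x] K(2)[of y] by linarith
  then have "2 * K \<in> osc_bounds z" using K(1) by (auto simp: osc_bounds_def intro: exI[of _ UNIV])
  then show ?thesis by blast
qed

lemma osc_nonneg: "z \<in> mspace linf \<Longrightarrow> 0 \<le> osc z"
  unfolding osc_def by (rule cInf_greatest[OF osc_bounds_nonempty]) (auto simp: osc_bounds_def)

lemma osc_le: "c \<in> osc_bounds z \<Longrightarrow> osc z \<le> c"
  unfolding osc_def by (rule cInf_lower[OF _ bdd_below_osc_bounds])

lemma continuous_map_osc_linf:
  "continuous_map (mtopology_of linf) euclideanreal (osc :: ('t::topological_space \<Rightarrow> real) \<Rightarrow> real)"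
proof (rule linf_lipschitzI[where L = 2])
  fix z w :: "'t \<Rightarrow> real" and K
  assume zw: "z \<in> mspace linf" "w \<in> mspace linf" and K: "\<And>x. \<bar>z x - w x\<bar> \<le> K"
  have "osc z - 2 * K \<le> c" if c: "c \<in> osc_bounds w" for c
  proof -
    have zK: "\<bar>z x - z y\<bar> \<le> c + 2 * K" if "\<bar>w x - w y\<bar> \<le> c" for x y
      using that K[of x] K[of y] by linarith
    have "\<exists>U. open U \<and> p \<in> U \<and> (\<forall>x\<in>U. \<forall>y\<in>U. \<bar>z x - z y\<bar> \<le> c + 2 * K)" for p
      using osc_boundsD[OF c, of p] zK by blast
    \<comment> \<open>\<open>undefined\<close> stands for an arbitrary point; the bound there forces
      \<open>K\<close> to be nonnegative.\<close>
    moreover have "0 \<le> c + 2 * K"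
      using c K[of undefined] by (auto simp: osc_bounds_def)
    ultimately have "c + 2 * K \<in> osc_bounds z"
      by (auto simp: osc_bounds_def)
    then show ?thesis using osc_le[of "c + 2 * K" z] by simp
  qed
  then have "osc z - 2 * K \<le> osc w"
    unfolding osc_def[of w] by (intro cInf_greatest osc_bounds_nonempty zw)
  then show "osc z \<le> osc w + 2 * K" by simp
qed

lemma osc_0_imp_continuous:
  fixes z :: "'t::topological_space \<Rightarrow> real"
  assumes "z \<in> mspace linf" "osc z = 0"
  shows "continuous_on UNIV z"
  unfolding continuous_on_def
proof (intro ballI tendstoI)
  fix p and e :: real assume "0 < e"
  then obtain c where c: "c \<in> osc_bounds z" "c < e"
    using assms cInf_lessD[OF osc_bounds_nonempty] by (metis osc_def)
  obtain U where U: "open U" "p \<in> U" "\<forall>x\<in>U. \<forall>y\<in>U. \<bar>z x - z y\<bar> \<le> c"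
    using osc_boundsD[OF c(1)] by blast
  have "\<forall>\<^sub>F x in at p. x \<in> U" using U by (intro topological_tendstoD[OF tendsto_ident_at]) auto
  then show "\<forall>\<^sub>F x in at p. dist (z x) (z p) < e"
    by eventually_elim (use U c(2) in \<open>force simp: dist_real_def\<close>)
qed

text \<open>The truncated oscillation is a bounded continuous functional whose outer expectations at
  \<open>Z n\<close> are at most \<open>\<bar>c n\<bar>\<close>. Its expectation at \<open>B\<close>
  is therefore 0, so the oscillation of \<open>B\<close> vanishes almost surely.\<close>

lemma weak_conv_linf_continuous_paths:
  fixes Z :: "nat \<Rightarrow> 'a \<Rightarrow> 't::topological_space \<Rightarrow> real"
  assumes wc: "weak_conv_linf M Z N B" and M: "prob_space M" and N: "prob_space N"
    and osc: "\<And>n. AE \<omega> in M. c n \<in> osc_bounds (Z n \<omega>)" and c: "c \<longlonglongrightarrow> 0"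
  shows "AE \<omega> in N. continuous_on UNIV (B \<omega>)"
proof -
  interpret M: prob_space M by fact
  interpret N: prob_space N by fact
  have B: "B \<in> measurable N borel_linf" and Z: "\<And>n \<omega>. \<omega> \<in> space M \<Longrightarrow> Z n \<omega> \<in> mspace linf"
    using wc by (auto simp: weak_conv_linf_def)
  have Bsp: "B \<omega> \<in> mspace linf" if "\<omega> \<in> space N" for \<omega>
    using measurable_space[OF B that] by (simp add: space_borel_linf)
  \<comment> \<open>The cap at 1 makes the functional bounded; the outer \<open>max\<close> keeps it
    nonnegative also outside \<open>linf\<close>, where \<open>osc_bounds\<close> may be
    empty.\<close>
  define h :: "('t \<Rightarrow> real) \<Rightarrow> real" where "h z = max 0 (min 1 (osc z))" for z
  have h_cont: "continuous_map (mtopology_of linf) euclideanreal h"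
    unfolding h_def by (intro continuous_map_real_min continuous_map_real_max continuous_map_osc_linf) auto
  have h01: "0 \<le> h z" "h z \<le> 1" for z by (auto simp: h_def)
  have [measurable]: "(\<lambda>\<omega>. h (B \<omega>)) \<in> borel_measurable N"
    using measurable_compose[OF B borel_measurable_linf[OF h_cont]] .
  have "bounded (h ` mspace linf)"
    using h01 by (auto simp: bounded_real intro!: exI[of _ 1])
  then have 1: "(\<lambda>n. outer_expectation M (\<lambda>\<omega>. h (Z n \<omega>))) \<longlonglongrightarrow> (\<integral>\<omega>. h (B \<omega>) \<partial>N)"
    using wc h_cont by (auto simp: weak_conv_linf_def)
  have "outer_expectation M (\<lambda>\<omega>. h (Z n \<omega>)) \<le> \<bar>c n\<bar>" for n
  proof -
    obtain A where A: "A \<in> null_sets M" "{\<omega> \<in> space M. c n \<notin> osc_bounds (Z n \<omega>)} \<subseteq> A"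
      using osc[of n] by (auto simp: eventually_ae_filter)
    have [measurable]: "A \<in> sets M" using A(1) by auto
    \<comment> \<open>An outer expectation asks for a majorant at every point, so the exceptional
      null set is paid for by its indicator.\<close>
    have "h (Z n \<omega>) \<le> \<bar>c n\<bar> + indicator A \<omega>" if "\<omega> \<in> space M" for \<omega>
    proof (cases "\<omega> \<in> A")
      case False
      then have "osc (Z n \<omega>) \<le> c n" using A(2) that by (intro osc_le) auto
      then show ?thesis using False by (auto simp: h_def)
    qed (use h01(2)[of "Z n \<omega>"] in simp)
    moreover have "integrable M (\<lambda>\<omega>. \<bar>c n\<bar> + indicator A \<omega> :: real)"
      by (intro Bochner_Integration.integrable_add) (auto simp: M.emeasure_eq_measure)
    ultimately have "outer_expectation M (\<lambda>\<omega>. h (Z n \<omega>)) \<le> (\<integral>\<omega>. \<bar>c n\<bar> + indicator A \<omega> \<partial>M)"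
      using h01(1) by (intro outer_expectation_le_integral[OF M, where K = 0]) auto
    also have "\<dots> = \<bar>c n\<bar>"
      using A(1) by (subst Bochner_Integration.integral_add)
        (auto simp: M.prob_space M.emeasure_eq_measure null_sets_def)
    finally show ?thesis .
  qed
  then have "(\<integral>\<omega>. h (B \<omega>) \<partial>N) \<le> 0"
    using tendsto_rabs_zero[OF c] by (intro LIMSEQ_le[OF 1]) auto
  then have "(\<integral>\<omega>. h (B \<omega>) \<partial>N) = 0"
    using h01(1) by (intro antisym integral_nonneg_AE) auto
  moreover have "integrable N (\<lambda>\<omega>. h (B \<omega>))"
    using h01 by (intro N.integrable_const_bound[of _ 1]) auto
  ultimately have "AE \<omega> in N. h (B \<omega>) = 0"
    using integral_nonneg_eq_0_iff_AE[of N "\<lambda>\<omega>. h (B \<omega>)"] h01(1) by simp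
  then show ?thesis
  proof (rule AE_mp, intro AE_I2 impI)
    fix \<omega> assume \<omega>: "\<omega> \<in> space N" "h (B \<omega>) = 0"
    then have "osc (B \<omega>) = 0" using osc_nonneg[OF Bsp[OF \<omega>(1)]] by (auto simp: h_def min_def split: if_splits)
    then show "continuous_on UNIV (B \<omega>)" using osc_0_imp_continuous Bsp \<omega>(1) by blast
  qed
qed

section \<open>Empirical distribution functions\<close>

lemma ext_vec_le_iff: "ext_vec v \<le> x \<longleftrightarrow> (\<forall>k. ereal (v $ k) \<le> x $ k)"
  by (simp add: ext_vec_def less_eq_vec_def)

lemma measurable_vec_nth [measurable]: "(\<lambda>v :: real ^ 'd. v $ k) \<in> borel_measurable borel"
  by (intro borel_measurable_continuous_onI continuous_intros)

lemma ext_vec_le_sets [measurable]: "{v :: real ^ 'd. ext_vec v \<le> x} \<in> sets borel"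
  unfolding ext_vec_le_iff by measurable

lemma joint_cdf_distr:
  fixes X :: "'a \<Rightarrow> real ^ 'd"
  assumes X: "X \<in> borel_measurable M"
  shows "joint_cdf (distr M borel X) (\<lambda>v. v) = joint_cdf M X"
proof
  fix x :: "ereal ^ 'd"
  have "{v. ext_vec v \<le> x} \<in> sets borel" by (rule ext_vec_le_sets)
  then show "joint_cdf (distr M borel X) (\<lambda>v. v) x = joint_cdf M X x"
    using measure_distr[OF X, of "{v. ext_vec v \<le> x}"]
    by (simp add: joint_cdf_def vimage_def Int_def conj_commute)
qed

text \<open>Balls of the transported metric are preimages of Euclidean balls under the continuous
  map \<open>\<phi>\<close>. Its open sets are thus open in the product topology, and continuity
  carries over.\<close>

lemma C_de_continuous_on:
  assumes "homeomorphism UNIV (cbox 0 1) \<phi> \<psi>" and F: "F \<in> C_de \<phi>"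
  shows "continuous_on UNIV F"
proof -
  have \<phi>: "continuous_on UNIV \<phi>" and inj: "\<phi> x = \<phi> y \<longleftrightarrow> x = y" for x y
    using assms(1) by (auto simp: homeomorphism_def) (metis UNIV_I)
  interpret D: Metric_space UNIV "\<lambda>x y. dist (\<phi> x) (\<phi> y)"
    by unfold_locales (auto simp: inj dist_commute dist_triangle)
  have op: "open U" if "openin D.mtopology U" for U
  proof (subst open_subopen, intro ballI)
    fix x assume "x \<in> U"
    then obtain r where r: "r > 0" "D.mball x r \<subseteq> U"
      using \<open>openin D.mtopology U\<close> by (auto simp: D.openin_mtopology)
    have "open (\<phi> -` ball (\<phi> x) r)" by (rule open_vimage[OF open_ball \<phi>])
    moreover have "\<phi> -` ball (\<phi> x) r = D.mball x r" by (auto simp: D.mball_def)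
    ultimately show "\<exists>T. open T \<and> x \<in> T \<and> T \<subseteq> U" using r by (metis D.centre_in_mball_iff UNIV_I)
  qed
  have "continuous_map D.mtopology euclideanreal F"
    using F by (simp add: C_de_def de_metric_def D.mtopology_of)
  then have "open (F -` U)" if "open U" for U
    using op[of "F -` U"] openin_continuous_map_preimage[of D.mtopology euclideanreal F U] that
    by (simp add: vimage_def)
  then show ?thesis by (simp add: continuous_on_open_vimage)
qed

section \<open>Absence of ties in the sample\<close>

text \<open>With all other coordinates set to infinity, \<open>F\<close> becomes the distribution
  function of coordinate \<open>k\<close>; its increment just to the left of \<open>t\<close> bounds
  the atom at \<open>t\<close> and tends to 0 by continuity.\<close>

lemma prob_coordinate_eq_0:
  fixes P :: "(real ^ 'd) measure"
  assumes P: "prob_space P" and sP [measurable_cong]: "sets P = sets borel"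
    and F: "continuous_on UNIV (joint_cdf P (\<lambda>v. v))"
  shows "measure P {v. v $ k = t} = 0"
proof -
  interpret prob_space P by fact
  have [simp]: "space P = UNIV" using sets_eq_imp_space_eq[OF sP] by simp
  let ?F = "joint_cdf P (\<lambda>v. v)"
  define x :: "ereal \<Rightarrow> ereal ^ 'd" where "x a = (\<chi> j. if j = k then a else \<infinity>)" for a
  have F_x: "?F (x (ereal s)) = measure P {v. v $ k \<le> s}" for s
  proof -
    have "ext_vec v \<le> x (ereal s) \<longleftrightarrow> v $ k \<le> s" for v
      by (auto simp: ext_vec_le_iff x_def)
    then show ?thesis by (simp add: joint_cdf_def)
  qed
  define s where "s m = t - 1 / real (Suc m)" for m
  have "(\<lambda>m. 1 / real (Suc m)) \<longlonglongrightarrow> 0"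
    by (rule LIMSEQ_Suc[OF lim_1_over_n])
  then have "s \<longlonglongrightarrow> t - 0" unfolding s_def by (intro tendsto_intros)
  then have "(\<lambda>m. x (ereal (s m))) \<longlonglongrightarrow> x (ereal t)"
    unfolding x_def by (intro vec_tendstoI) auto
  then have "(\<lambda>m. ?F (x (ereal (s m)))) \<longlonglongrightarrow> ?F (x (ereal t))"
    using continuous_on_tendsto_compose[OF F] by simp
  then have "(\<lambda>m. ?F (x (ereal t)) - ?F (x (ereal (s m)))) \<longlonglongrightarrow> 0"
    using tendsto_diff[OF tendsto_const[of "?F (x (ereal t))"]] by fastforce
  moreover have "measure P {v. v $ k = t} \<le> ?F (x (ereal t)) - ?F (x (ereal (s m)))" for m
  proof -
    have "s m < t" by (simp add: s_def)
    have "measure P {v. v $ k = t} + measure P {v. v $ k \<le> s m} = measure P ({v. v $ k = t} \<union> {v. v $ k \<le> s m})"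
      using \<open>s m < t\<close> by (intro finite_measure_Union[symmetric]) auto
    also have "\<dots> \<le> measure P {v. v $ k \<le> t}"
      using \<open>s m < t\<close> by (intro finite_measure_mono) auto
    finally show ?thesis by (simp add: F_x)
  qed
  ultimately have "measure P {v. v $ k = t} \<le> 0"
    by (intro LIMSEQ_le_const) auto
  then show ?thesis using measure_nonneg[of P] by (intro antisym) auto
qed

text \<open>By independence the joint law is a product. Each section of the diagonal is a singleton,
  null for the law of \<open>V\<close>, so the diagonal is null by Fubini.\<close>

lemma (in prob_space) AE_indep_neq:
  fixes U V :: "'a \<Rightarrow> real"
  assumes ind: "indep_var borel U borel V" and V: "\<And>t. prob {\<omega> \<in> space M. V \<omega> = t} = 0"
  shows "AE \<omega> in M. U \<omega> \<noteq> V \<omega>"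
proof -
  have UV [measurable]: "U \<in> borel_measurable M" "V \<in> borel_measurable M"
    and eq: "distr M borel U \<Otimes>\<^sub>M distr M borel V = distr M (borel \<Otimes>\<^sub>M borel) (\<lambda>\<omega>. (U \<omega>, V \<omega>))"
    using ind by (auto simp: indep_var_distribution_eq)
  interpret V: prob_space "distr M borel V" by (rule prob_space_distr) simp
  let ?E = "{p \<in> space (borel \<Otimes>\<^sub>M borel). fst p = snd p} :: (real \<times> real) set"
  have E: "?E \<in> sets (borel \<Otimes>\<^sub>M borel)" by measurable
  have "emeasure (distr M borel V) (Pair x -` ?E) = 0" for x
  proof -
    have "Pair x -` ?E = {x}" by (auto simp: space_pair_measure)
    then show ?thesis
      using V[of x] by (simp add: emeasure_distr vimage_def Int_def conj_commute emeasure_eq_measure)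
  qed
  then have "emeasure (distr M borel U \<Otimes>\<^sub>M distr M borel V) ?E = 0"
    using E by (subst V.emeasure_pair_measure_alt) (auto cong: sets_pair_measure_cong)
  then have "emeasure M {\<omega> \<in> space M. U \<omega> = V \<omega>} = 0"
    unfolding eq using E
    by (subst (asm) emeasure_distr) (auto simp: vimage_def Int_def conj_commute space_pair_measure)
  then show ?thesis
    by (intro AE_I[of _ _ "{\<omega> \<in> space M. U \<omega> = V \<omega>}"]) auto
qed

text \<open>Distinct projections are independent with atomless coordinates, so each single tie is a
  null event, and there are countably many triples \<open>i\<close>, \<open>j\<close>,
  \<open>k\<close>.\<close>

lemma AE_PiM_no_ties:
  fixes P :: "(real ^ 'd) measure"
  assumes P: "prob_space P" and sP [measurable_cong]: "sets P = sets borel"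
    and atom: "\<And>k t. measure P {v. v $ k = t} = 0"
  shows "AE \<omega> in (\<Pi>\<^sub>M i\<in>(UNIV :: nat set). P). \<forall>i j k. i \<noteq> j \<longrightarrow> \<omega> i $ k \<noteq> \<omega> j $ k"
proof -
  let ?Q = "\<Pi>\<^sub>M i\<in>(UNIV :: nat set). P"
  interpret Q: prob_space ?Q by (rule prob_space_PiM[OF P])
  have sp [simp]: "space P = UNIV" using sets_eq_imp_space_eq[OF sP] by simp
  have comp: "distr ?Q P (\<lambda>\<omega>. \<omega> i) = P" for i
    using P by (intro distr_PiM_component) auto
  have ind: "Q.indep_vars (\<lambda>_. P) (\<lambda>i \<omega>. \<omega> i) UNIV"
    by (subst Q.indep_vars_iff_distr_eq_PiM) (auto simp: comp restrict_UNIV distr_id)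
  have "AE \<omega> in ?Q. \<omega> i $ k \<noteq> \<omega> j $ k" if "i \<noteq> j" for i j :: nat and k
  proof (rule Q.AE_indep_neq)
    have "Q.indep_var (PiM {i} (\<lambda>_. P)) (\<lambda>\<omega>. restrict (\<lambda>i. \<omega> i) {i}) (PiM {j} (\<lambda>_. P)) (\<lambda>\<omega>. restrict (\<lambda>i. \<omega> i) {j})"
      using that by (intro Q.indep_var_restrict[OF ind]) auto
    then have "Q.indep_var borel ((\<lambda>\<omega>. \<omega> i $ k) \<circ> (\<lambda>\<omega>. restrict (\<lambda>i. \<omega> i) {i})) borel ((\<lambda>\<omega>. \<omega> j $ k) \<circ> (\<lambda>\<omega>. restrict (\<lambda>i. \<omega> i) {j}))"
      by (rule Q.indep_var_compose) measurable
    then show "Q.indep_var borel (\<lambda>\<omega>. \<omega> i $ k) borel (\<lambda>\<omega>. \<omega> j $ k)"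
      by (simp add: comp_def)
    show "Q.prob {\<omega> \<in> space ?Q. \<omega> j $ k = t} = 0" for t
    proof -
      have "measure (distr ?Q P (\<lambda>\<omega>. \<omega> j)) {v. v $ k = t} = Q.prob {\<omega> \<in> space ?Q. \<omega> j $ k = t}"
        by (subst measure_distr) (auto simp: vimage_def Int_def conj_commute)
      then show ?thesis by (simp add: comp atom)
    qed
  qed
  then show ?thesis by (simp add: AE_all_countable AE_impI)
qed

section \<open>Local oscillation of the empirical process\<close>

text \<open>A function of the sample path alone, so that it serves both the coordinate projections
  and the given sample.\<close>

abbreviation ecdf :: "nat \<Rightarrow> (nat \<Rightarrow> real ^ 'd) \<Rightarrow> ereal ^ 'd \<Rightarrow> real" where
  "ecdf \<equiv> emp_cdf (\<lambda>i v. v i)"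

lemma ecdf_01: "0 \<le> ecdf n v x" "ecdf n v x \<le> 1"
proof -
  have "(\<Sum>i<n. if ext_vec (v i) \<le> x then 1 else 0) \<le> (\<Sum>i<n. 1::real)"
    by (intro sum_mono) auto
  then show "ecdf n v x \<le> 1" by (simp add: emp_cdf_def divide_le_eq)
  show "0 \<le> ecdf n v x" unfolding emp_cdf_def by (intro mult_nonneg_nonneg sum_nonneg) auto
qed

text \<open>Near \<open>p\<close> only those sample points count which share a coordinate with \<open>p\<close>, and without ties
  there is at most one of them per coordinate.\<close>

lemma ecdf_local_oscillation:
  fixes v :: "nat \<Rightarrow> real ^ 'd"
  assumes ties: "\<And>i j k. i \<noteq> j \<Longrightarrow> v i $ k \<noteq> v j $ k"
  shows "\<exists>U. open U \<and> p \<in> U \<and> (\<forall>x\<in>U. \<forall>y\<in>U. \<bar>ecdf n v x - ecdf n v y\<bar> \<le> real CARD('d) / real n)"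
proof -
  \<comment> \<open>A neighbourhood of \<open>p $ k\<close> lying, for every sample value other than
    \<open>p $ k\<close>, on the same side of that value as \<open>p $ k\<close> does.\<close>
  define W where "W k = (\<Inter>i<n. {a. (ereal (v i $ k) < p $ k \<longrightarrow> ereal (v i $ k) < a) \<and>
      (p $ k < ereal (v i $ k) \<longrightarrow> a < ereal (v i $ k))})" for k
  define U where "U = {x. \<forall>k. x $ k \<in> W k}"
  define C where "C = (\<Union>k. {i. i < n \<and> ereal (v i $ k) = p $ k})"
  have "open (W k)" for k
    unfolding W_def by (intro open_INT ballI open_Collect_conj open_Collect_imp)
      (auto simp: greaterThan_def[symmetric] lessThan_def[symmetric])
  then have "open U" unfolding U_def by (intro open_vector_box) auto
  \<comment> \<open>If \<open>i\<close> counts for \<open>x\<close> but not for \<open>y\<close>,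
    then in some coordinate its value separates \<open>y\<close> from \<open>x\<close>; inside
    \<open>W k\<close> the only value that can do so is \<open>p $ k\<close>.\<close>
  have inC: "i \<in> C" if xy: "x \<in> U" "y \<in> U" and i: "i < n" "ext_vec (v i) \<le> x" "\<not> ext_vec (v i) \<le> y" for i x y
  proof -
    obtain k where k: "y $ k < ereal (v i $ k)" "ereal (v i $ k) \<le> x $ k"
      using i by (auto simp: ext_vec_le_iff not_le)
    have "x $ k \<in> W k" "y $ k \<in> W k" using xy by (auto simp: U_def)
    then have "ereal (v i $ k) = p $ k"
      using k i(1) unfolding W_def by (auto intro!: antisym leI)
    then show ?thesis using i(1) by (auto simp: C_def)
  qed
  have "card {i. i < n \<and> ereal (v i $ k) = p $ k} \<le> 1" for k
    using ties by (subst One_nat_def, subst card_le_Suc0_iff_eq) (auto, metis ereal.inject)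
  then have "(\<Sum>k\<in>UNIV. card {i. i < n \<and> ereal (v i $ k) = p $ k}) \<le> (\<Sum>k\<in>(UNIV :: 'd set). 1)"
    by (rule sum_mono)
  then have card_C: "card C \<le> CARD('d)"
    using card_UN_le[of "UNIV :: 'd set" "\<lambda>k. {i. i < n \<and> ereal (v i $ k) = p $ k}"]
    unfolding C_def by simp
  have "\<bar>ecdf n v x - ecdf n v y\<bar> \<le> real CARD('d) / real n" if xy: "x \<in> U" "y \<in> U" for x y
  proof -
    let ?I = "\<lambda>x i. if ext_vec (v i) \<le> x then 1 else (0::real)"
    have "\<bar>(\<Sum>i<n. ?I x i) - (\<Sum>i<n. ?I y i)\<bar> \<le> (\<Sum>i<n. \<bar>?I x i - ?I y i\<bar>)"
      unfolding sum_subtractf[symmetric] by (rule sum_abs)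
    also have "\<dots> \<le> (\<Sum>i<n. if i \<in> C then 1 else 0)"
      using inC[OF xy] inC[OF xy(2,1)] by (intro sum_mono) auto
    also have "\<dots> = real (card C)"
      by (subst sum.inter_filter[symmetric]) (auto simp: C_def intro!: arg_cong[of _ _ card])
    finally have "\<bar>(\<Sum>i<n. ?I x i) - (\<Sum>i<n. ?I y i)\<bar> \<le> real CARD('d)"
      using card_C by simp
    then have "\<bar>(\<Sum>i<n. ?I x i) - (\<Sum>i<n. ?I y i)\<bar> / real n \<le> real CARD('d) / real n"
      by (rule divide_right_mono) simp
    then show ?thesis
      by (simp add: emp_cdf_def diff_divide_distrib[symmetric])
  qed
  moreover have "p \<in> U" by (auto simp: U_def W_def)
  ultimately show ?thesis using \<open>open U\<close> by blast
qed

text \<open>The empirical part oscillates locally by at most \<open>CARD('d) / n\<close>; the added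
  1 allows \<open>F\<close> an oscillation of \<open>1 / n\<close>.\<close>

lemma osc_bounds_empirical_process:
  fixes v :: "nat \<Rightarrow> real ^ 'd"
  assumes ties: "\<And>i j k. i \<noteq> j \<Longrightarrow> v i $ k \<noteq> v j $ k" and F: "continuous_on UNIV F"
  shows "sqrt (real n) * ((real CARD('d) + 1) / real n) \<in> osc_bounds (\<lambda>x. sqrt (real n) * (ecdf n v x - F x))"
  unfolding osc_bounds_def
proof (intro CollectI conjI allI)
  fix p :: "ereal ^ 'd"
  show "\<exists>U. open U \<and> p \<in> U \<and> (\<forall>x\<in>U. \<forall>y\<in>U. \<bar>sqrt (real n) * (ecdf n v x - F x) - sqrt (real n) * (ecdf n v y - F y)\<bar>
      \<le> sqrt (real n) * ((real CARD('d) + 1) / real n))"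
  proof (cases "n = 0")
    case False
    obtain U where U: "open U" "p \<in> U" "\<And>x y. x \<in> U \<Longrightarrow> y \<in> U \<Longrightarrow> \<bar>ecdf n v x - ecdf n v y\<bar> \<le> real CARD('d) / real n"
      using ecdf_local_oscillation[where v = v and p = p and n = n, OF ties] by blast
    \<comment> \<open>Half of \<open>1 / n\<close> as radius, since two values in the ball are
      compared with each other.\<close>
    let ?V = "F -` ball (F p) (1 / (2 * real n))"
    have V: "open ?V" "p \<in> ?V" using open_vimage[OF open_ball F] False by auto
    have "\<bar>sqrt (real n) * (ecdf n v x - F x) - sqrt (real n) * (ecdf n v y - F y)\<bar>
        \<le> sqrt (real n) * ((real CARD('d) + 1) / real n)" if xy: "x \<in> U \<inter> ?V" "y \<in> U \<inter> ?V" for x y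
    proof -
      have "\<bar>F x - F y\<bar> \<le> 1 / real n"
        using xy by (auto simp: dist_real_def field_simps abs_if split: if_splits)
      then have "\<bar>(ecdf n v x - F x) - (ecdf n v y - F y)\<bar> \<le> real CARD('d) / real n + 1 / real n"
        using U(3)[of x y] xy by auto
      then have "sqrt (real n) * \<bar>(ecdf n v x - F x) - (ecdf n v y - F y)\<bar>
          \<le> sqrt (real n) * (real CARD('d) / real n + 1 / real n)"
        by (rule mult_left_mono) simp
      then show ?thesis
        unfolding right_diff_distrib[symmetric] abs_mult add_divide_distrib by simp
    qed
    then show ?thesis using U V by (intro exI[of _ "U \<inter> ?V"]) auto
  \<comment> \<open>For \<open>n = 0\<close> both the process and the bound are 0.\<close>
  qed (auto intro: exI[of _ UNIV])
qed auto

section \<open>Measurability of suprema of the empirical process\<close>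

text \<open>A countable set from which every point can be approached from above. Infinity is
  included for points with infinite coordinates; minus infinity is itself a limit of rationals from
  above.\<close>

definition rational_grid :: "(ereal ^ 'd) set" where
  "rational_grid = {q. \<forall>k. q $ k \<in> insert \<infinity> (range (\<lambda>r. ereal (real_of_rat r)))}"

lemma countable_rational_grid: "countable (rational_grid :: (ereal ^ 'd) set)"
proof -
  let ?A = "insert \<infinity> (range (\<lambda>r. ereal (real_of_rat r)))"
  have "countable (Pi\<^sub>E (UNIV :: 'd set) (\<lambda>_. ?A))"
    by (intro countable_PiE) auto
  moreover have "(rational_grid :: (ereal ^ 'd) set) \<subseteq> vec_lambda ` Pi\<^sub>E UNIV (\<lambda>_. ?A)"
  proof
    fix q :: "ereal ^ 'd" assume "q \<in> rational_grid"
    then have "vec_nth q \<in> Pi\<^sub>E UNIV (\<lambda>_. ?A)" by (auto simp: rational_grid_def)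
    then show "q \<in> vec_lambda ` Pi\<^sub>E UNIV (\<lambda>_. ?A)" by (intro image_eqI[of _ _ "vec_nth q"]) (simp_all add: vec_lambda_eta)
  qed
  ultimately show ?thesis by (rule countable_subset[OF _ countable_image, rotated])
qed

lemma rational_grid_nonempty: "(rational_grid :: (ereal ^ 'd) set) \<noteq> {}"
proof -
  have "(\<chi> k. \<infinity>) \<in> (rational_grid :: (ereal ^ 'd) set)" by (simp add: rational_grid_def)
  then show ?thesis by blast
qed

lemma ereal_rational_approx_above:
  "\<exists>q. (\<forall>m. q m \<in> insert \<infinity> (range (\<lambda>r. ereal (real_of_rat r))) \<and> a \<le> q m) \<and> q \<longlonglongrightarrow> a"
proof (cases "a = \<infinity>")
  case True then show ?thesis by (intro exI[of _ "\<lambda>_. \<infinity>"]) auto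
next
  case False
  then have "a < \<infinity>" by simp
  then obtain u where u: "\<And>n. a < u n" "u \<longlonglongrightarrow> a"
    using approx_from_above_dense_linorder[of a \<infinity>] by blast
  have "\<exists>r::rat. a < real_of_rat r \<and> real_of_rat r < u n" for n
    using ereal_dense3[OF u(1)] by blast
  then obtain r :: "nat \<Rightarrow> rat" where r: "\<And>n. a < real_of_rat (r n)" "\<And>n. real_of_rat (r n) < u n"
    by metis
  have "(\<lambda>n. ereal (real_of_rat (r n))) \<longlonglongrightarrow> a"
    using r by (intro tendsto_sandwich[OF _ _ tendsto_const u(2)] always_eventually) (auto intro: less_imp_le)
  then show ?thesis
    using r by (intro exI[of _ "\<lambda>n. ereal (real_of_rat (r n))"]) (auto intro: less_imp_le)
qed

lemma rational_grid_approx_above: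
  fixes x :: "ereal ^ 'd"
  obtains q where "\<And>m. q m \<in> rational_grid" "\<And>m. x \<le> q m" "q \<longlonglongrightarrow> x"
proof -
  let ?A = "insert \<infinity> (range (\<lambda>r. ereal (real_of_rat r)))"
  have "\<forall>k. \<exists>q. (\<forall>m. q m \<in> ?A \<and> x $ k \<le> q m) \<and> q \<longlonglongrightarrow> x $ k"
    by (intro allI ereal_rational_approx_above)
  from choice[OF this] obtain u where u: "\<forall>k. (\<forall>m. u k m \<in> ?A \<and> x $ k \<le> u k m) \<and> u k \<longlonglongrightarrow> x $ k" ..
  show thesis
  proof (rule that[of "\<lambda>m. \<chi> k. u k m"])
    show "(\<lambda>m. \<chi> k. u k m) \<longlonglongrightarrow> x" by (rule vec_tendstoI) (simp add: u)
  qed (use u in \<open>auto simp: rational_grid_def less_eq_vec_def\<close>)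
qed

text \<open>A counted sample point stays counted above \<open>x\<close>; one not counted exceeds
  \<open>x\<close> strictly in some coordinate, hence eventually also \<open>q m\<close>. With
  finitely many points the values become constant.\<close>

lemma ecdf_right_continuous:
  assumes "\<And>m. x \<le> q m" "q \<longlonglongrightarrow> x"
  shows "\<forall>\<^sub>F m in sequentially. ecdf n v (q m) = ecdf n v x"
proof -
  have "\<forall>\<^sub>F m in sequentially. ext_vec (v i) \<le> q m \<longleftrightarrow> ext_vec (v i) \<le> x" for i
  proof (cases "ext_vec (v i) \<le> x")
    case True
    then show ?thesis using assms(1) order_trans by (intro always_eventually) blast
  next
    case False
    then obtain k where "x $ k < ereal (v i $ k)" by (auto simp: ext_vec_le_iff not_le)
    then have "\<forall>\<^sub>F m in sequentially. q m $ k < ereal (v i $ k)"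
      by (intro order_tendstoD(2)[OF tendsto_vec_nth[OF assms(2)]])
    then show ?thesis
    proof eventually_elim
      case (elim m)
      then have "\<not> ext_vec (v i) \<le> q m" unfolding ext_vec_le_iff by (meson not_le)
      then show ?case using False by simp
    qed
  qed
  then have "\<forall>\<^sub>F m in sequentially. \<forall>i\<in>{..<n}. ext_vec (v i) \<le> q m \<longleftrightarrow> ext_vec (v i) \<le> x"
    by (intro eventually_ball_finite) auto
  then show ?thesis
    by eventually_elim (auto simp: emp_cdf_def intro!: sum.cong)
qed

lemma SUP_eq_SUP_dense:
  fixes g :: "'t \<Rightarrow> real"
  assumes bdd: "bdd_above (range g)" and A: "A \<noteq> {}"
    and approx: "\<And>x. \<exists>q. (\<forall>m :: nat. q m \<in> A) \<and> (\<lambda>m. g (q m)) \<longlonglongrightarrow> g x"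
  shows "(SUP x. g x) = (SUP x\<in>A. g x)"
proof (rule antisym)
  have bA: "bdd_above (g ` A)" using bdd by (rule bdd_above_mono) auto
  show "(SUP x. g x) \<le> (SUP x\<in>A. g x)"
  proof (rule cSUP_least)
    fix x
    obtain q where "\<forall>m :: nat. q m \<in> A" "(\<lambda>m. g (q m)) \<longlonglongrightarrow> g x" using approx by blast
    then show "g x \<le> (SUP x\<in>A. g x)"
      by (intro LIMSEQ_le_const2 exI[of _ 0]) (auto intro: cSUP_upper bA)
  qed simp
  show "(SUP x\<in>A. g x) \<le> (SUP x. g x)" using A bdd by (intro cSUP_subset_mono) auto
qed

text \<open>Right continuity reduces the supremum to the countable grid. The function
  \<open>f\<close> will be the identity, the negation or the absolute value.\<close>

lemma measurable_SUP_ecdf: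
  fixes P :: "(real ^ 'd) measure"
  assumes sP [measurable_cong]: "sets P = sets borel"
    and G: "continuous_on UNIV G" "\<And>x. \<bar>G x\<bar> \<le> 1" and f: "continuous_on UNIV f"
  shows "(\<lambda>\<omega>. SUP x. f (ecdf n \<omega> x - G x) :: real) \<in> borel_measurable (\<Pi>\<^sub>M i\<in>(UNIV :: nat set). P)"
proof -
  \<comment> \<open>Both \<open>ecdf\<close> and \<open>G\<close> are bounded by 1, so their
    difference stays in this compact interval and the suprema are of bounded sets.\<close>
  have "bounded (f ` cball 0 2)"
    by (intro compact_imp_bounded compact_continuous_image continuous_on_subset[OF f]) auto
  then obtain C where C: "\<And>a. \<bar>a\<bar> \<le> 2 \<Longrightarrow> f a \<le> C"
    by (force simp: bounded_real abs_le_iff)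
  have fC: "f (ecdf n v x - G x) \<le> C" for v x
    using ecdf_01[of n v x] G(2)[of x] by (intro C) linarith
  have "(SUP x. f (ecdf n v x - G x)) = (SUP x\<in>rational_grid. f (ecdf n v x - G x))" for v
  proof (rule SUP_eq_SUP_dense)
    fix x :: "ereal ^ 'd"
    obtain q where q: "\<And>m. q m \<in> rational_grid" "\<And>m. x \<le> q m" "q \<longlonglongrightarrow> x"
      using rational_grid_approx_above[of x] by blast
    have "(\<lambda>m. ecdf n v (q m)) \<longlonglongrightarrow> ecdf n v x"
      by (rule tendsto_eventually[OF ecdf_right_continuous[OF q(2,3)]])
    moreover have "(\<lambda>m. G (q m)) \<longlonglongrightarrow> G x"
      using continuous_on_tendsto_compose[OF G(1) q(3)] by simp
    ultimately have "(\<lambda>m. f (ecdf n v (q m) - G (q m))) \<longlonglongrightarrow> f (ecdf n v x - G x)"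
      using continuous_on_tendsto_compose[OF f tendsto_diff] by simp
    then show "\<exists>q. (\<forall>m. q m \<in> rational_grid) \<and> (\<lambda>m. f (ecdf n v (q m) - G (q m))) \<longlonglongrightarrow> f (ecdf n v x - G x)"
      using q(1) by blast
  qed (use fC rational_grid_nonempty in \<open>auto intro!: bdd_aboveI2\<close>)
  moreover have [measurable]: "f \<in> borel_measurable borel"
    using f by (rule borel_measurable_continuous_onI)
  have "(\<lambda>\<omega>. ecdf n \<omega> x) \<in> borel_measurable (\<Pi>\<^sub>M i\<in>(UNIV :: nat set). P)" for x :: "ereal ^ 'd"
    unfolding emp_cdf_def ext_vec_le_iff by measurable
  note [measurable] = this
  have "(\<lambda>\<omega>. SUP x\<in>rational_grid. f (ecdf n \<omega> x - G x)) \<in> borel_measurable (\<Pi>\<^sub>M i\<in>(UNIV :: nat set). P)"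
    using fC by (intro borel_measurable_cSUP countable_rational_grid) (auto intro!: bdd_aboveI2)
  ultimately show ?thesis by simp
qed

text \<open>Independence and equal laws together say that the whole sequence, as one random element,
  has the canonical product law.\<close>

lemma iid_sample_law:
  fixes X :: "'a \<Rightarrow> real ^ 'd"
  assumes M: "prob_space M" and iid: "iid_sample M X Xs"
  shows "(\<lambda>\<omega> i. Xs i \<omega>) \<in> measurable M (\<Pi>\<^sub>M i\<in>UNIV. distr M borel X)"
    and "distr M (\<Pi>\<^sub>M i\<in>UNIV. distr M borel X) (\<lambda>\<omega> i. Xs i \<omega>) = (\<Pi>\<^sub>M i\<in>UNIV. distr M borel X)"
proof -
  interpret prob_space M by fact
  have ind: "indep_vars (\<lambda>_. borel) Xs UNIV" and law: "\<And>i. distr M borel (Xs i) = distr M borel X"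
    using iid by (auto simp: iid_sample_def)
  have Xs: "random_variable borel (Xs i)" for i using ind by (auto simp: indep_vars_def)
  have sets: "sets (\<Pi>\<^sub>M i\<in>(UNIV :: nat set). distr M borel X) = sets (\<Pi>\<^sub>M i\<in>(UNIV :: nat set). (borel :: (real ^ 'd) measure))"
    by (intro sets_PiM_cong) auto
  have "(\<lambda>\<omega>. \<lambda>i\<in>UNIV. Xs i \<omega>) \<in> measurable M (\<Pi>\<^sub>M i\<in>UNIV. distr M borel X)"
    by (intro measurable_restrict) (simp add: Xs)
  then show "(\<lambda>\<omega> i. Xs i \<omega>) \<in> measurable M (\<Pi>\<^sub>M i\<in>UNIV. distr M borel X)"
    by (simp add: restrict_UNIV)
  have "distr M (\<Pi>\<^sub>M i\<in>UNIV. distr M borel X) (\<lambda>\<omega> i. Xs i \<omega>) = distr M (\<Pi>\<^sub>M i\<in>UNIV. borel) (\<lambda>\<omega>. \<lambda>i\<in>UNIV. Xs i \<omega>)"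
    by (intro distr_cong refl sets) (simp add: restrict_UNIV)
  then show "distr M (\<Pi>\<^sub>M i\<in>UNIV. distr M borel X) (\<lambda>\<omega> i. Xs i \<omega>) = (\<Pi>\<^sub>M i\<in>UNIV. distr M borel X)"
    using indep_vars_iff_distr_eq_PiM[where I = UNIV and M' = "\<lambda>_. borel" and X = Xs] ind Xs
    by (simp add: law)
qed

lemma joint_cdf_01:
  assumes "prob_space M" shows "0 \<le> joint_cdf M X x" "joint_cdf M X x \<le> 1"
  using prob_space.prob_le_1[OF assms] by (auto simp: joint_cdf_def)

section \<open>Limits of perturbed suprema\<close>

text \<open>\<open>slope 0\<close> is the directional derivative at \<open>h\<close> of the supremum over \<open>S\<close>, along the
  perturbations \<open>p \<mapsto> c p * z (g p)\<close>; \<open>excess r\<close> are its difference quotients.\<close>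

locale perturbed_sup =
  fixes S :: "'p::topological_space set" and h c :: "'p \<Rightarrow> real" and g :: "'p \<Rightarrow> 't::topological_space"
  assumes S: "compact S" "S \<noteq> {}"
    and h: "continuous_on S h" and c: "continuous_on S c" and g: "continuous_on S g"
    and c_le_1: "p \<in> S \<Longrightarrow> \<bar>c p\<bar> \<le> 1"
begin

definition excess :: "real \<Rightarrow> ('t \<Rightarrow> real) \<Rightarrow> real" where
  "excess r z = r * ((SUP p\<in>S. h p + c p * z (g p) / r) - (SUP p\<in>S. h p))"

definition slope :: "real \<Rightarrow> ('t \<Rightarrow> real) \<Rightarrow> real" where
  "slope \<epsilon> z = (SUP p\<in>near_max S h \<epsilon>. c p * z (g p))"

lemma bdd_above_h: "bdd_above (h ` S)"
  by (rule bounded_imp_bdd_above[OF compact_imp_bounded[OF compact_continuous_image[OF h S(1)]]])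

lemma abs_direction_le:
  assumes "p \<in> S" "\<And>x. \<bar>z x\<bar> \<le> K"
  shows "\<bar>c p * z (g p)\<bar> \<le> K"
  using mult_mono[OF c_le_1[OF assms(1)] assms(2)[of "g p"]] by (simp add: abs_mult)

lemma continuous_map_slope:
  "0 \<le> \<epsilon> \<Longrightarrow> continuous_map (mtopology_of linf) euclideanreal (slope \<epsilon>)"
  unfolding slope_def
  by (rule continuous_map_SUP_linf[OF near_max_nonempty[OF S h]]) (auto simp: near_max_def c_le_1)

lemma slope_le_excess:
  assumes "z \<in> mspace linf" "0 < r"
  shows "slope 0 z \<le> excess r z"
proof -
  obtain K where "\<And>x. \<bar>z x\<bar> \<le> K" using linf_boundE[OF assms(1)] by blast
  then have "c p * z (g p) \<le> K" if "p \<in> S" for p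
    using abs_direction_le[OF that] by (meson abs_le_D1)
  then show ?thesis
    unfolding slope_def excess_def
    by (intro sup_excess_ge[OF near_max_nonempty[OF S h] bdd_above_h _ assms(2)]) auto
qed

lemma excess_le_slope:
  assumes "\<And>x. \<bar>z x\<bar> \<le> K" "0 < r" "2 * K \<le> \<epsilon> * r"
  shows "excess r z \<le> slope \<epsilon> z"
  unfolding slope_def excess_def
  by (intro sup_excess_le[OF near_max_nonempty[OF S h] bdd_above_h _ assms(2,3)] abs_direction_le assms(1)) auto

lemma tendsto_slope:
  assumes z: "continuous_on UNIV z" and "\<epsilon> \<longlonglongrightarrow> 0" "\<And>m. 0 \<le> \<epsilon> m"
  shows "(\<lambda>m. slope (\<epsilon> m) z) \<longlonglongrightarrow> slope 0 z"
proof -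
  have "continuous_on S (\<lambda>p. c p * z (g p))"
    by (intro continuous_on_mult c continuous_on_compose2[OF z g]) auto
  from tendsto_SUP_near_max[OF S h this assms(2,3)] show ?thesis
    by (simp add: slope_def)
qed

end

locale empirical_limit =
  fixes Q :: "'a measure" and N :: "'b measure"
    and Z :: "nat \<Rightarrow> 'a \<Rightarrow> 't::topological_space \<Rightarrow> real" and B :: "'b \<Rightarrow> 't \<Rightarrow> real"
  assumes Q: "prob_space Q" and N: "prob_space N" and wc: "weak_conv_linf Q Z N B"
    and B_cont: "AE \<omega> in N. continuous_on UNIV (B \<omega>)"
begin

lemma Z_bounded: "\<omega> \<in> space Q \<Longrightarrow> Z n \<omega> \<in> mspace linf"
  using wc by (auto simp: weak_conv_linf_def)

lemma inverse_Suc: "(\<lambda>m. 1 / real (Suc m)) \<longlonglongrightarrow> 0" "0 \<le> 1 / real (Suc m)"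
  by (rule LIMSEQ_Suc[OF lim_1_over_n]) simp

text \<open>The condition \<open>2 * K \<le> \<epsilon> * r\<close> of
  \<open>excess_le_slope\<close> for \<open>K = m\<close>, \<open>\<epsilon> = 1 / (m + 1)\<close>
  and \<open>r = sqrt n\<close>.\<close>

lemma eventually_sqrt_large: "\<forall>\<^sub>F n in sequentially. 2 * real m \<le> 1 / real (Suc m) * sqrt (real n)"
proof -
  have "filterlim (\<lambda>n. sqrt (real n)) at_top sequentially"
    by (rule filterlim_compose[OF sqrt_at_top filterlim_real_sequentially])
  then have "\<forall>\<^sub>F n in sequentially. 2 * real m * real (Suc m) \<le> sqrt (real n)"
    by (simp add: filterlim_at_top)
  then show ?thesis by eventually_elim (simp add: field_simps)
qed

text \<open>The index \<open>m\<close> serves at once as bound on the paths and, through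
  \<open>1 / (m + 1)\<close>, as width of the near-maximisers. The identity \<open>eq\<close> is
  asked for positive \<open>n\<close>, where the scale \<open>sqrt n\<close> is nonzero.\<close>

lemma conv_excess:
  assumes "perturbed_sup S h c (g :: 'p::topological_space \<Rightarrow> 't)"
    and T: "\<And>n. T n \<in> borel_measurable Q"
    and eq: "\<And>n \<omega>. 0 < n \<Longrightarrow> \<omega> \<in> space Q \<Longrightarrow> T n \<omega> = perturbed_sup.excess S h c g (sqrt (real n)) (Z n \<omega>)"
  shows "conv_in_distribution Q T N (\<lambda>\<omega>. perturbed_sup.slope S h c g 0 (B \<omega>))"
proof -
  interpret perturbed_sup S h c g by fact
  show ?thesis
  proof (rule conv_in_distribution_squeeze[OF wc Q N T, where \<Psi> = "\<lambda>m. slope (1 / real (Suc m))"])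
    show "\<forall>\<^sub>F n in sequentially. \<forall>\<omega>\<in>space Q. slope 0 (Z n \<omega>) \<le> T n \<omega>"
      using eventually_gt_at_top[of 0]
      by eventually_elim (auto simp: eq intro!: slope_le_excess Z_bounded)
    show "\<forall>\<^sub>F n in sequentially. \<forall>\<omega>\<in>space Q. (\<forall>x. \<bar>Z n \<omega> x\<bar> \<le> real m) \<longrightarrow> T n \<omega> \<le> slope (1 / real (Suc m)) (Z n \<omega>)" for m
      using eventually_gt_at_top[of 0] eventually_sqrt_large[of m]
    proof eventually_elim
      case (elim n)
      then show ?case by (auto simp: eq intro!: excess_le_slope[where K = "real m"] simp del: of_nat_Suc)
    qed
    show "AE \<omega> in N. (\<lambda>m. slope (1 / real (Suc m)) (B \<omega>)) \<longlonglongrightarrow> slope 0 (B \<omega>)"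
      using B_cont by eventually_elim (rule tendsto_slope[OF _ inverse_Suc])
  qed (auto intro: continuous_map_slope)
qed

text \<open>Limits of the two summands separately would not determine that of the sum; here both are
  functionals of the same \<open>Z n\<close>, so their bounds can be added before the squeeze. The
  amplitude is such a sum.\<close>

lemma conv_excess_add:
  assumes "perturbed_sup S1 h1 c1 (g1 :: 'p::topological_space \<Rightarrow> 't)" "perturbed_sup S2 h2 c2 (g2 :: 'q::topological_space \<Rightarrow> 't)"
    and T: "\<And>n. T n \<in> borel_measurable Q"
    and eq: "\<And>n \<omega>. 0 < n \<Longrightarrow> \<omega> \<in> space Q \<Longrightarrow> T n \<omega> =
      perturbed_sup.excess S1 h1 c1 g1 (sqrt (real n)) (Z n \<omega>) + perturbed_sup.excess S2 h2 c2 g2 (sqrt (real n)) (Z n \<omega>)"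
  shows "conv_in_distribution Q T N
    (\<lambda>\<omega>. perturbed_sup.slope S1 h1 c1 g1 0 (B \<omega>) + perturbed_sup.slope S2 h2 c2 g2 0 (B \<omega>))"
proof -
  interpret A1: perturbed_sup S1 h1 c1 g1 by fact
  interpret A2: perturbed_sup S2 h2 c2 g2 by fact
  show ?thesis
  proof (rule conv_in_distribution_squeeze[OF wc Q N T, where
        \<Phi> = "\<lambda>z. A1.slope 0 z + A2.slope 0 z" and
        \<Psi> = "\<lambda>m z. A1.slope (1 / real (Suc m)) z + A2.slope (1 / real (Suc m)) z"])
    show "\<forall>\<^sub>F n in sequentially. \<forall>\<omega>\<in>space Q. A1.slope 0 (Z n \<omega>) + A2.slope 0 (Z n \<omega>) \<le> T n \<omega>"
      using eventually_gt_at_top[of 0]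
      by eventually_elim (auto simp: eq intro!: add_mono A1.slope_le_excess A2.slope_le_excess Z_bounded)
    show "\<forall>\<^sub>F n in sequentially. \<forall>\<omega>\<in>space Q. (\<forall>x. \<bar>Z n \<omega> x\<bar> \<le> real m) \<longrightarrow>
        T n \<omega> \<le> A1.slope (1 / real (Suc m)) (Z n \<omega>) + A2.slope (1 / real (Suc m)) (Z n \<omega>)" for m
      using eventually_gt_at_top[of 0] eventually_sqrt_large[of m]
    proof eventually_elim
      case (elim n)
      then show ?case
        by (auto simp: eq intro!: add_mono A1.excess_le_slope[where K = "real m"] A2.excess_le_slope[where K = "real m"]
            simp del: of_nat_Suc)
    qed
    show "AE \<omega> in N. (\<lambda>m. A1.slope (1 / real (Suc m)) (B \<omega>) + A2.slope (1 / real (Suc m)) (B \<omega>))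
        \<longlonglongrightarrow> A1.slope 0 (B \<omega>) + A2.slope 0 (B \<omega>)"
      using B_cont by eventually_elim (intro tendsto_add A1.tendsto_slope A2.tendsto_slope inverse_Suc)
  qed (auto intro!: continuous_map_add A1.continuous_map_slope A2.continuous_map_slope)
qed

end

section \<open>The three statistics of the empirical distribution function\<close>

theorem corollary3p1:
  fixes M :: "'a measure" and N :: "'b measure"
    and X Y :: "'a \<Rightarrow> real ^ 'd"
    and Xs :: "nat \<Rightarrow> 'a \<Rightarrow> real ^ 'd"
    and B :: "'b \<Rightarrow> ereal ^ 'd \<Rightarrow> real"
    and F G :: "ereal ^ 'd \<Rightarrow> real"
    and Fn :: "nat \<Rightarrow> 'a \<Rightarrow> ereal ^ 'd \<Rightarrow> real"
    and \<phi> :: "ereal ^ 'd \<Rightarrow> real ^ 'd" and \<psi> :: "real ^ 'd \<Rightarrow> ereal ^ 'd"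
  assumes "prob_space M"
    and "X \<in> borel_measurable M" and "Y \<in> borel_measurable M"
    and "nondegenerate M X" and "nondegenerate M Y"
    and "homeomorphism UNIV (cbox 0 1) \<phi> \<psi>"
    and "F = joint_cdf M X" and "G = joint_cdf M Y"
    and "F \<noteq> G"
    and "F \<in> C_de \<phi>" and "G \<in> C_de \<phi>"
    and "iid_sample M X Xs"
    and "Fn = emp_cdf Xs"
    and "F_brownian_bridge (distr M borel X) N B"
  shows "conv_in_distribution M
           (\<lambda>n \<omega>. sqrt (real n) * (sup_norm (\<lambda>x. Fn n \<omega> x - G x) - sup_norm (\<lambda>x. F x - G x)))
           N (\<lambda>\<omega>. SUP x\<in>Mplus (\<lambda>x. \<bar>F x - G x\<bar>). B \<omega> x * sgn (F x - G x)) \<and>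
         conv_in_distribution M
           (\<lambda>n \<omega>. sqrt (real n) * ((SUP x. Fn n \<omega> x - G x) - (SUP x. F x - G x)))
           N (\<lambda>\<omega>. SUP x\<in>Mplus (\<lambda>x. F x - G x). B \<omega> x) \<and>
         conv_in_distribution M
           (\<lambda>n \<omega>. sqrt (real n) * (amp (\<lambda>x. Fn n \<omega> x - G x) - amp (\<lambda>x. F x - G x)))
           N (\<lambda>\<omega>. (SUP x\<in>Mplus (\<lambda>x. F x - G x). B \<omega> x)
                 - (INF x\<in>Mminus (\<lambda>x. F x - G x). B \<omega> x))"
proof -
  note M = assms(1) and X = assms(2) and hom = assms(6) and iid = assms(12)
  define P where "P = distr M borel X"
  \<comment> \<open>The bridge is the limit of the process on this canonical space, so all three
    limits are proved there and transferred to \<open>M\<close> at the end.\<close>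
  define Q where "Q = (\<Pi>\<^sub>M i\<in>(UNIV :: nat set). P)"
  have P: "prob_space P" unfolding P_def by (rule prob_space.prob_space_distr[OF M X])
  have Q: "prob_space Q" unfolding Q_def by (rule prob_space_PiM[OF P])
  have sP: "sets P = sets borel" by (simp add: P_def)
  have F_eq: "joint_cdf P (\<lambda>v. v) = F"
    unfolding P_def assms(7) by (rule joint_cdf_distr[OF X])
  have F: "continuous_on UNIV F" and G: "continuous_on UNIV G"
    using C_de_continuous_on[OF hom] assms(10,11) by auto
  have F01: "0 \<le> F x" "F x \<le> 1" and G01: "0 \<le> G x" "G x \<le> 1" for x
    unfolding assms(7,8) by (rule joint_cdf_01[OF M])+
  have G1: "\<bar>G x\<bar> \<le> 1" for x using G01[of x] by simp
  define Z where "Z n \<omega> x = sqrt (real n) * (ecdf n \<omega> x - F x)" for n \<omega> x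
  have N: "prob_space N" and wc: "weak_conv_linf Q Z N B"
    using assms(14) unfolding F_brownian_bridge_def P_def[symmetric] Let_def F_eq Q_def Z_def by auto
  have B_cont: "AE \<omega> in N. continuous_on UNIV (B \<omega>)"
  proof (rule weak_conv_linf_continuous_paths[OF wc Q N])
    have "AE \<omega> in Q. \<forall>i j k. i \<noteq> j \<longrightarrow> \<omega> i $ k \<noteq> \<omega> j $ k"
      unfolding Q_def
      by (rule AE_PiM_no_ties[OF P sP prob_coordinate_eq_0[OF P sP]]) (simp add: F_eq F)
    then show "AE \<omega> in Q. sqrt (real n) * ((real CARD('d) + 1) / real n) \<in> osc_bounds (Z n \<omega>)" for n
      by eventually_elim (unfold Z_def, rule osc_bounds_empirical_process[OF _ F], blast)
    \<comment> \<open>The oscillation bound simplifies to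
      \<open>(CARD('d) + 1) / sqrt n\<close>.\<close>
    have "(\<lambda>n. (real CARD('d) + 1) * inverse (sqrt (real n))) \<longlonglongrightarrow> 0"
      by (intro tendsto_mult_right_zero tendsto_inverse_0_at_top
          filterlim_compose[OF sqrt_at_top filterlim_real_sequentially])
    then show "(\<lambda>n. sqrt (real n) * ((real CARD('d) + 1) / real n)) \<longlonglongrightarrow> 0"
      by (simp add: sqrt_divide_self_eq[symmetric] mult.commute)
  qed
  interpret empirical_limit Q N Z B
    by (rule empirical_limit.intro[OF Q N wc B_cont])
  define h where "h x = F x - G x" for x
  have h: "continuous_on UNIV h"
    unfolding h_def by (intro continuous_intros F G)
  have h1: "\<bar>h x\<bar> \<le> 1" for x using F01[of x] G01[of x] by (auto simp: h_def)
  have bdd: "bdd_above (range h)" "bdd_above (range (\<lambda>x. - h x))" "bdd_above (range (\<lambda>x. \<bar>h x\<bar>))"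
    using h1 by (auto intro!: bdd_aboveI2[of _ _ 1] simp: abs_le_iff minus_le_iff)
  \<comment> \<open>The extended space is the image of the closed cube under
    \<open>\<psi>\<close>.\<close>
  have compact: "compact (UNIV :: (ereal ^ 'd) set)"
    using hom compact_continuous_image[of "cbox 0 1" \<psi>] by (auto simp: homeomorphism_def)
  have dev: "ecdf n \<omega> x - G x = h x + Z n \<omega> x / sqrt (real n)" if "0 < n" for n \<omega> x
    using that by (simp add: h_def Z_def)
  have meas_SUP: "(\<lambda>\<omega>. SUP x. f (ecdf n \<omega> x - G x)) \<in> borel_measurable Q" if "continuous_on UNIV f" for f :: "real \<Rightarrow> real" and n
    unfolding Q_def by (rule measurable_SUP_ecdf[OF sP G G1 that])
  have transfer: "conv_in_distribution M (\<lambda>n \<omega>. T n (Fn n \<omega>)) N L"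
    if "conv_in_distribution Q (\<lambda>n \<omega>. T n (ecdf n \<omega>)) N L" for T L
  proof -
    have "Fn n \<omega> = ecdf n (\<lambda>i. Xs i \<omega>)" for n \<omega>
      by (simp add: assms(13) emp_cdf_def fun_eq_iff)
    then show ?thesis
      using conv_in_distribution_transfer[OF that, of "\<lambda>\<omega> i. Xs i \<omega>" M] iid_sample_law[OF M iid]
      by (simp add: Q_def P_def)
  qed
  \<comment> \<open>On the reals \<open>Inf\<close> is defined by this reflection, so the identity
    holds for arbitrary sets, bounded or not.\<close>
  have minus_INF: "(INF x\<in>A. f x) = - (SUP x\<in>A. - f x)" for f :: "ereal ^ 'd \<Rightarrow> real" and A
    by (simp add: Inf_real_def image_image)
  have up: "perturbed_sup UNIV h (\<lambda>_. 1) (\<lambda>x. x)"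
    using compact h by unfold_locales auto
  \<comment> \<open>The infimum of \<open>h\<close> is minus the supremum of \<open>- h\<close>, and
    the perturbation then enters with weight -1.\<close>
  have down: "perturbed_sup UNIV (\<lambda>x. - h x) (\<lambda>_. - 1) (\<lambda>x. x)"
    using compact h by unfold_locales (auto intro: continuous_intros)
  have Mplus: "Mplus h = near_max UNIV h 0"
    unfolding near_max_0[OF bdd(1)] by (simp add: Mplus_def)
  have Mminus: "Mminus h = near_max UNIV (\<lambda>x. - h x) 0"
    unfolding near_max_0[OF bdd(2)] by (auto simp: Mminus_def minus_INF)
  have ii: "conv_in_distribution Q (\<lambda>n \<omega>. sqrt (real n) * ((SUP x. ecdf n \<omega> x - G x) - (SUP x. h x)))
      N (\<lambda>\<omega>. SUP x\<in>Mplus h. B \<omega> x)"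
  proof -
    have "(\<lambda>\<omega>. sqrt (real n) * ((SUP x. ecdf n \<omega> x - G x) - (SUP x. h x))) \<in> borel_measurable Q" for n
    proof -
      note [measurable] = meas_SUP[of "\<lambda>a. a", OF continuous_on_id]
      show ?thesis by measurable
    qed
    moreover have "sqrt (real n) * ((SUP x. ecdf n \<omega> x - G x) - (SUP x. h x)) =
        perturbed_sup.excess UNIV h (\<lambda>_. 1) (\<lambda>x. x) (sqrt (real n)) (Z n \<omega>)" if "0 < n" for n \<omega>
      unfolding perturbed_sup.excess_def[OF up] dev[OF that] mult_1 ..
    ultimately have "conv_in_distribution Q (\<lambda>n \<omega>. sqrt (real n) * ((SUP x. ecdf n \<omega> x - G x) - (SUP x. h x)))
        N (\<lambda>\<omega>. perturbed_sup.slope UNIV h (\<lambda>_. 1) (\<lambda>x. x) 0 (B \<omega>))"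
      by (rule conv_excess[OF up])
    then show ?thesis
      unfolding perturbed_sup.slope_def[OF up] Mplus mult_1 .
  qed
  have iii: "conv_in_distribution Q (\<lambda>n \<omega>. sqrt (real n) * (amp (\<lambda>x. ecdf n \<omega> x - G x) - amp h))
      N (\<lambda>\<omega>. (SUP x\<in>Mplus h. B \<omega> x) - (INF x\<in>Mminus h. B \<omega> x))"
  proof -
    have "(\<lambda>\<omega>. sqrt (real n) * (amp (\<lambda>x. ecdf n \<omega> x - G x) - amp h)) \<in> borel_measurable Q" for n
    proof -
      note [measurable] = meas_SUP[of "\<lambda>a. a", OF continuous_on_id] meas_SUP[of "\<lambda>a. - a", OF continuous_on_minus[OF continuous_on_id]]
      show ?thesis unfolding amp_def minus_INF by measurable
    qed
    moreover have "sqrt (real n) * (amp (\<lambda>x. ecdf n \<omega> x - G x) - amp h) =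
        perturbed_sup.excess UNIV h (\<lambda>_. 1) (\<lambda>x. x) (sqrt (real n)) (Z n \<omega>) +
        perturbed_sup.excess UNIV (\<lambda>x. - h x) (\<lambda>_. - 1) (\<lambda>x. x) (sqrt (real n)) (Z n \<omega>)" if "0 < n" for n \<omega>
    proof -
      have "- h x + - 1 * Z n \<omega> x / sqrt (real n) = - (h x + 1 * Z n \<omega> x / sqrt (real n))" for x by simp
      then show ?thesis
        unfolding perturbed_sup.excess_def[OF up] perturbed_sup.excess_def[OF down] amp_def minus_INF dev[OF that]
        by (simp only: distrib_left[symmetric] mult_1) simp
    qed
    ultimately have "conv_in_distribution Q (\<lambda>n \<omega>. sqrt (real n) * (amp (\<lambda>x. ecdf n \<omega> x - G x) - amp h)) N
       (\<lambda>\<omega>. perturbed_sup.slope UNIV h (\<lambda>_. 1) (\<lambda>x. x) 0 (B \<omega>) + perturbed_sup.slope UNIV (\<lambda>x. - h x) (\<lambda>_. - 1) (\<lambda>x. x) 0 (B \<omega>))"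
      by (rule conv_excess_add[OF up down])
    then show ?thesis
      unfolding perturbed_sup.slope_def[OF up] perturbed_sup.slope_def[OF down] Mplus Mminus minus_INF by simp
  qed
  \<comment> \<open>\<open>\<bar>h\<bar>\<close> is not of the form covered by \<^locale>\<open>perturbed_sup\<close>, but its supremum is that of
    \<open>s * h x\<close> over \<open>x\<close> and the signs \<open>s\<close>.\<close>
  let ?S = "(UNIV :: (ereal ^ 'd) set) \<times> {- 1, 1 :: real}" and ?h = "\<lambda>p. snd p * h (fst p)"
  have signed: "perturbed_sup ?S ?h snd fst"
  proof
    show "compact ?S" by (intro compact_Times compact) auto
    show "continuous_on ?S ?h"
      by (intro continuous_intros continuous_on_compose2[OF h]) auto
  qed (auto intro: continuous_intros)
  have SUP_signed: "(SUP p\<in>?S. snd p * u (fst p)) = (SUP x. \<bar>u x\<bar>)"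
    if u: "\<And>x. \<bar>u x\<bar> \<le> K" for u :: "ereal ^ 'd \<Rightarrow> real" and K
  proof (rule antisym)
    have b: "bdd_above (range (\<lambda>x. \<bar>u x\<bar>))" using u by (intro bdd_aboveI2) auto
    show "(SUP p\<in>?S. snd p * u (fst p)) \<le> (SUP x. \<bar>u x\<bar>)"
      by (rule cSUP_least) (auto intro!: cSUP_upper2[OF b])
    have bS: "bdd_above ((\<lambda>p. snd p * u (fst p)) ` ?S)"
      using u by (intro bdd_aboveI2[of _ _ K]) (auto simp: abs_le_iff)
    show "(SUP x. \<bar>u x\<bar>) \<le> (SUP p\<in>?S. snd p * u (fst p))"
    proof (rule cSUP_least)
      fix x
      show "\<bar>u x\<bar> \<le> (SUP p\<in>?S. snd p * u (fst p))"
        using cSUP_upper[OF _ bS, of "(x, 1)"] cSUP_upper[OF _ bS, of "(x, - 1)"] by (simp add: abs_if)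
    qed simp
  qed
  \<comment> \<open>Since \<open>F\<close> and \<open>G\<close> differ, the supremum of
    \<open>\<bar>h\<bar>\<close> is positive, so \<open>h\<close> is nonzero at its maximisers and a
    maximising pair has the sign \<open>sgn (h x)\<close>. At a zero of \<open>h\<close> both signs
    would do, whereas \<open>sgn 0 = 0\<close> is neither.\<close>
  obtain x0 where "h x0 \<noteq> 0" using assms(9) by (auto simp: h_def fun_eq_iff)
  then have pos: "0 < (SUP x. \<bar>h x\<bar>)"
    using cSUP_upper[OF _ bdd(3), of x0] by simp
  have near_signed: "near_max ?S ?h 0 = (\<lambda>x. (x, sgn (h x))) ` Mplus (\<lambda>x. \<bar>h x\<bar>)"
  proof -
    have bS: "bdd_above (?h ` ?S)" by (rule perturbed_sup.bdd_above_h[OF signed])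
    define m where "m = (SUP x. \<bar>h x\<bar>)"
    have "0 < m" using pos by (simp add: m_def)
    have "p \<in> (\<lambda>x. (x, sgn (h x))) ` {x. \<bar>h x\<bar> = m}" if "p \<in> ?S" "?h p = m" for p
      using that \<open>0 < m\<close> by (intro image_eqI[of _ _ "fst p"] prod_eqI) (auto simp: sgn_if abs_if)
    moreover have "(x, sgn (h x)) \<in> ?S" "?h (x, sgn (h x)) = m" if "\<bar>h x\<bar> = m" for x
      using that \<open>0 < m\<close> by (auto simp: sgn_if)
    ultimately have "{p \<in> ?S. ?h p = m} = (\<lambda>x. (x, sgn (h x))) ` {x. \<bar>h x\<bar> = m}"
      by blast
    then show ?thesis
      unfolding near_max_0[OF bS] SUP_signed[where u = h, OF h1] Mplus_def m_def .
  qed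
  have i: "conv_in_distribution Q (\<lambda>n \<omega>. sqrt (real n) * (sup_norm (\<lambda>x. ecdf n \<omega> x - G x) - sup_norm h))
      N (\<lambda>\<omega>. SUP x\<in>Mplus (\<lambda>x. \<bar>h x\<bar>). B \<omega> x * sgn (h x))"
  proof -
    have "(\<lambda>\<omega>. sqrt (real n) * (sup_norm (\<lambda>x. ecdf n \<omega> x - G x) - sup_norm h)) \<in> borel_measurable Q" for n
    proof -
      note [measurable] = meas_SUP[of "\<lambda>a. \<bar>a\<bar>", OF continuous_on_rabs[OF continuous_on_id]]
      show ?thesis unfolding sup_norm_def by measurable
    qed
    moreover have "sqrt (real n) * (sup_norm (\<lambda>x. ecdf n \<omega> x - G x) - sup_norm h) =
        perturbed_sup.excess ?S ?h snd fst (sqrt (real n)) (Z n \<omega>)" if "0 < n" for n \<omega>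
    proof -
      have "\<bar>ecdf n \<omega> x - G x\<bar> \<le> 1" for x
        using ecdf_01[of n \<omega> x] G01[of x] by (auto simp: abs_le_iff)
      from SUP_signed[where u = "\<lambda>x. ecdf n \<omega> x - G x", OF this] SUP_signed[where u = h, OF h1] show ?thesis
        by (simp add: perturbed_sup.excess_def[OF signed] sup_norm_def dev[OF that] distrib_left)
    qed
    ultimately have "conv_in_distribution Q (\<lambda>n \<omega>. sqrt (real n) * (sup_norm (\<lambda>x. ecdf n \<omega> x - G x) - sup_norm h))
        N (\<lambda>\<omega>. perturbed_sup.slope ?S ?h snd fst 0 (B \<omega>))"
      by (rule conv_excess[OF signed])
    then show ?thesis
      by (simp add: perturbed_sup.slope_def[OF signed] near_signed image_image mult.commute)
  qed
  show ?thesis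
    by (intro conjI
      transfer[where T = "\<lambda>n f. sqrt (real n) * (sup_norm (\<lambda>x. f x - G x) - sup_norm h)", OF i, unfolded h_def]
      transfer[where T = "\<lambda>n f. sqrt (real n) * ((SUP x. f x - G x) - (SUP x. h x))", OF ii, unfolded h_def]
      transfer[where T = "\<lambda>n f. sqrt (real n) * (amp (\<lambda>x. f x - G x) - amp h)", OF iii, unfolded h_def])
qed

end
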